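(* Let $\mathcal A(\mathbb R)$, $\mathcal A_1(\mathbb R)$, $\operatorname{Diff}_{\mathcal A}(\mathbb R)$, $\operatorname{Diff}_{\mathcal A_1}(\mathbb R)$ and the right-invariant $\dot H^1$-metric $G$ be as in the context. (i) For every $X\in\mathcal A_1(\mathbb R)$ one has $\operatorname{ad}(X)^*\check G(X)\in\check G(\mathcal A_1(\mathbb R))$, namely $\operatorname{ad}(X)^*\check G(X)=\check G\big(\tfrac12(X^2)'-\tfrac12\int_{-\infty}^x X'(y)^2\,dy\big)$. Consequently the geodesic equation of $G$ on $\operatorname{Diff}_{\mathcal A_1}(\mathbb R)$ exists: a smooth curve $\varphi(t)$ in $\operatorname{Diff}_{\mathcal A_1}(\mathbb R)$ is a geodesic if and only if $u=\varphi_t\circ\varphi^{-1}$ satisfies the Hunter--Saxton equation $$u_t=-uu_x+\tfrac12\int_{-\infty}^x u_x(z)^2\,dz.$$ (ii) The geodesic distance induced by $G$ on $\operatorname{Diff}_{\mathcal A_1}(\mathbb R)$ is positive, i.e. $d(\varphi_0,\varphi_1)>0$ whenever $\varphi_0\neq\varphi_1$. (iii) On the subgroup $\operatorname{Diff}_{\mathcal A}(\mathbb R)$ the geodesic equation does not exist: for every $X\in\mathcal A(\mathbb R)$ with $X\neq0$, $\operatorname{ad}(X)^*\check G(X)\notin\check G(\mathcal A(\mathbb R))$.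
   Context: $\mathcal A(\mathbb R)$ denotes any one of the spaces $C^\infty_c(\mathbb R)$ (smooth compactly supported functions), $\mathcal S(\mathbb R)$ (rapidly decreasing smooth functions), or $W^{\infty,1}(\mathbb R)=\{f\in C^\infty(\mathbb R): f^{(k)}\in L^1(\mathbb R)\ \forall k\ge0\}$. Correspondingly $\mathcal A_1(\mathbb R)=\{x\mapsto\int_{-\infty}^x g(y)\,dy: g\in\mathcal A(\mathbb R)\}$ (antiderivatives vanishing at $-\infty$; they are bounded and have a limit at $+\infty$). $\operatorname{Diff}_{\mathcal A}(\mathbb R)=\{\varphi=\mathrm{Id}+f: f\in\mathcal A(\mathbb R),\ f'>-1\}$ and $\operatorname{Diff}_{\mathcal A_1}(\mathbb R)=\{\varphi=\mathrm{Id}+f: f\in\mathcal A_1(\mathbb R),\ f'>-1\}$; these are regular Lie groups under composition with Lie algebras $\mathcal A(\mathbb R)$, resp. $\mathcal A_1(\mathbb R)$. The right-invariant homogeneous Sobolev ($\dot H^1$) metric is $G_\varphi(X\circ\varphi,Y\circ\varphi)=G_{\mathrm{Id}}(X,Y)=\int_{\mathbb R}X'(x)Y'(x)\,dx$. $\check G:\mathfrak g\to\mathfrak g^*$ is $\langle\check G(X),Z\rangle=G_{\mathrm{Id}}(X,Z)$, and the Lie algebra adjoint action is $\operatorname{ad}(X)Z=X'Z-XZ'$, with dual $\langle\operatorname{ad}(X)^*\alpha,Z\rangle=\langle\alpha,\operatorname{ad}(X)Z\rangle$. The geodesic equation of a right-invariant metric is said to exist when $\operatorname{ad}(X)^*\check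 G(X)\in\check G(\mathfrak g)$ for all $X\in\mathfrak g$; it then reads $u_t=-\check G^{-1}\operatorname{ad}(u)^*\check G(u)$ for the right logarithmic derivative $u=\varphi_t\circ\varphi^{-1}$ of a curve $\varphi$, and its solutions are exactly the critical points of the energy $\tfrac12\int G_\varphi(\varphi_t,\varphi_t)\,dt$ with fixed endpoints. The geodesic distance $d(\varphi_0,\varphi_1)$ is the infimum of the lengths $\int_0^1\sqrt{G_{\varphi(t)}(\varphi_t,\varphi_t)}\,dt$ over smooth paths in the group joining $\varphi_0$ to $\varphi_1$. *)

theory Defs
  imports "HOL-Analysis.Analysis"
begin

definition smooth1 :: "(real \<Rightarrow> real) \<Rightarrow> bool" where
  "smooth1 f \<longleftrightarrow> (\<forall>k x. ((deriv ^^ k) f) differentiable (at x))"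

datatype space_kind = CompactSupp | Schwartz | W_inf_1

definition Aspace :: "space_kind \<Rightarrow> (real \<Rightarrow> real) set" where
  "Aspace k = (case k of
      CompactSupp \<Rightarrow> {f. smooth1 f \<and> bounded {x. f x \<noteq> 0}}
    | Schwartz \<Rightarrow> {f. smooth1 f \<and>
          (\<forall>j n. bounded (range (\<lambda>x. \<bar>x\<bar> ^ n * (deriv ^^ j) f x)))}
    | W_inf_1 \<Rightarrow> {f. smooth1 f \<and> (\<forall>j. integrable lborel ((deriv ^^ j) f))})"

definition A1space :: "space_kind \<Rightarrow> (real \<Rightarrow> real) set" where
  "A1space k = {(\<lambda>x. set_lebesgue_integral lborel {..x} g) | g. g \<in> Aspace k}"

definition DiffA :: "space_kind \<Rightarrow> (real \<Rightarrow> real) set" where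
  "DiffA k = {(\<lambda>x. x + f x) | f. f \<in> Aspace k \<and> (\<forall>x. deriv f x > -1)}"

definition DiffA1 :: "space_kind \<Rightarrow> (real \<Rightarrow> real) set" where
  "DiffA1 k = {(\<lambda>x. x + f x) | f. f \<in> A1space k \<and> (\<forall>x. deriv f x > -1)}"

definition G_Id :: "(real \<Rightarrow> real) \<Rightarrow> (real \<Rightarrow> real) \<Rightarrow> real" where
  "G_Id X Y = integral\<^sup>L lborel (\<lambda>x. deriv X x * deriv Y x)"

definition G_at :: "(real \<Rightarrow> real) \<Rightarrow> (real \<Rightarrow> real) \<Rightarrow> (real \<Rightarrow> real) \<Rightarrow> real" where
  "G_at phi h h' = G_Id (h \<circ> inv phi) (h' \<circ> inv phi)"

definition ad :: "(real \<Rightarrow> real) \<Rightarrow> (real \<Rightarrow> real) \<Rightarrow> (real \<Rightarrow> real)" where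
  "ad X Z = (\<lambda>x. deriv X x * Z x - X x * deriv Z x)"

definition Gcheck :: "(real \<Rightarrow> real) \<Rightarrow> (real \<Rightarrow> real) \<Rightarrow> real" where
  "Gcheck Y = (\<lambda>Z. G_Id Y Z)"

definition ad_star :: "(real \<Rightarrow> real) \<Rightarrow> ((real \<Rightarrow> real) \<Rightarrow> real) \<Rightarrow> ((real \<Rightarrow> real) \<Rightarrow> real)" where
  "ad_star X \<alpha> = (\<lambda>Z. \<alpha> (ad X Z))"

definition in_Gcheck_image :: "(real \<Rightarrow> real) set \<Rightarrow> ((real \<Rightarrow> real) \<Rightarrow> real) \<Rightarrow> bool" where
  "in_Gcheck_image g \<alpha> \<longleftrightarrow> (\<exists>Y\<in>g. \<forall>Z\<in>g. \<alpha> Z = Gcheck Y Z)"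

text \<open>Joint C-infinity regularity of functions of (t,x) on an open set U.\<close>
coinductive smooth2_on :: "(real \<times> real) set \<Rightarrow> (real \<times> real \<Rightarrow> real) \<Rightarrow> bool"
  for U where
  "(\<forall>p\<in>U. (f has_derivative (\<lambda>(s, y). f1 p * s + f2 p * y)) (at p))
    \<Longrightarrow> smooth2_on U f1 \<Longrightarrow> smooth2_on U f2 \<Longrightarrow> smooth2_on U f"

definition dt :: "(real \<Rightarrow> real \<Rightarrow> real) \<Rightarrow> real \<Rightarrow> real \<Rightarrow> real" where
  "dt phi t x = deriv (\<lambda>s. phi s x) t"

definition rlog :: "(real \<Rightarrow> real \<Rightarrow> real) \<Rightarrow> real \<Rightarrow> real \<Rightarrow> real" where
  "rlog phi t = dt phi t \<circ> inv (phi t)"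

definition smooth_curve :: "space_kind \<Rightarrow> real set \<Rightarrow> (real \<Rightarrow> real \<Rightarrow> real) \<Rightarrow> bool" where
  "smooth_curve k J phi \<longleftrightarrow> smooth2_on (J \<times> UNIV) (\<lambda>(t, x). phi t x)
     \<and> (\<forall>t\<in>J. phi t \<in> DiffA1 k \<and> dt phi t \<in> A1space k)"

text \<open>Geodesic: u_t = - Gcheck^{-1} ad(u)^* Gcheck(u), i.e. u_t in A1 and
  Gcheck(u_t) = - ad(u)^* Gcheck(u) as functionals on A1.\<close>
definition is_geodesic :: "space_kind \<Rightarrow> real set \<Rightarrow> (real \<Rightarrow> real \<Rightarrow> real) \<Rightarrow> bool" where
  "is_geodesic k J phi \<longleftrightarrow> (\<forall>t\<in>J. dt (rlog phi) t \<in> A1space k \<and>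
     (\<forall>Z\<in>A1space k. Gcheck (dt (rlog phi) t) Z = - ad_star (rlog phi t) (Gcheck (rlog phi t)) Z))"

definition hunter_saxton :: "real set \<Rightarrow> (real \<Rightarrow> real \<Rightarrow> real) \<Rightarrow> bool" where
  "hunter_saxton J u \<longleftrightarrow> (\<forall>t\<in>J. \<forall>x.
     dt u t x = - u t x * deriv (u t) x
                + 1/2 * set_lebesgue_integral lborel {..x} (\<lambda>z. (deriv (u t) z)\<^sup>2))"

definition smooth_paths :: "space_kind \<Rightarrow> (real \<Rightarrow> real) \<Rightarrow> (real \<Rightarrow> real) \<Rightarrow> (real \<Rightarrow> real \<Rightarrow> real) set" where
  "smooth_paths k \<phi>0 \<phi>1 = {phi. (\<exists>\<epsilon>>0. smooth2_on ({-\<epsilon><..<1+\<epsilon>} \<times> UNIV) (\<lambda>(t, x). phi t x))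
     \<and> (\<forall>t\<in>{0..1}. phi t \<in> DiffA1 k \<and> dt phi t \<in> A1space k)
     \<and> phi 0 = \<phi>0 \<and> phi 1 = \<phi>1}"

definition path_length :: "(real \<Rightarrow> real \<Rightarrow> real) \<Rightarrow> ennreal" where
  "path_length phi = (\<integral>\<^sup>+ t. indicator {0..1} t * ennreal (sqrt (G_at (phi t) (dt phi t) (dt phi t))) \<partial>lborel)"

definition geodesic_distance :: "space_kind \<Rightarrow> (real \<Rightarrow> real) \<Rightarrow> (real \<Rightarrow> real) \<Rightarrow> ennreal" where
  "geodesic_distance k \<phi>0 \<phi>1 = (INF phi\<in>smooth_paths k \<phi>0 \<phi>1. path_length phi)"

end

theory Submission
  imports Defs "HOL-Probability.Sinc_Integral"
begin

text \<open>For (i), \<open>ad(X)\<^sup>* G(X)\<close> and \<open>G(F)\<close> with \<open>F = (X\<^sup>2)'/2 - 1/2 \<integral> X'\<^sup>2\<close> differ by the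
  integral of the derivative of an element of \<open>\<A>\<close>, which vanishes. The geodesic equation then
  says \<open>u_t = -F(u)\<close> because \<open>u\<close> stays in \<open>\<A>\<^sub>1\<close> and \<open>G\<close> is positive definite there.
  For (iii), a representing \<open>Y\<close> would have to be \<open>F\<close>, but \<open>F\<close> tends to
  \<open>- 1/2 \<integral> X'\<^sup>2\<close> at \<open>+\<infinity>\<close> while \<open>Y\<close> tends to \<open>0\<close>.
  For (ii), a path of diffeomorphisms transports an interval, and by Cauchy--Schwarz the square root of
  the length of this interval changes at a rate of at most half the speed of the path; two distinct
  diffeomorphisms give different lengths to some interval.\<close>

section \<open>Integrable functions on the line and their antiderivatives\<close>

text \<open>If \<open>c\<close> were nonzero, \<open>\<bar>f\<bar>\<close> would exceed
  \<open>\<bar>c\<bar>/2\<close> from some \<open>N\<close> on, so its integral over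
  \<open>{N..N+n}\<close> would grow linearly in \<open>n\<close> past the L1 norm.\<close>

lemma integrable_tendsto_at_top_zero:
  fixes f :: "real \<Rightarrow> real"
  assumes int: "integrable lborel f" and lim: "(f \<longlongrightarrow> c) at_top"
  shows "c = 0"
proof (rule ccontr)
  assume c: "c \<noteq> 0"
  have "eventually (\<lambda>x. dist (f x) c < \<bar>c\<bar>/2) at_top"
    using lim c by (intro tendstoD) auto
  then obtain N where N: "\<And>x. x \<ge> N \<Longrightarrow> dist (f x) c < \<bar>c\<bar>/2"
    by (auto simp: eventually_at_top_linorder)
  have bound: "n * (\<bar>c\<bar>/2) \<le> (\<integral>x. \<bar>f x\<bar> \<partial>lborel)" if "n \<ge> 0" for n
  proof -
    have "(\<integral>x. indicator {N..N+n} x * (\<bar>c\<bar>/2) \<partial>lborel) \<le> (\<integral>x. \<bar>f x\<bar> \<partial>lborel)"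
    proof (rule integral_mono)
      fix x
      show "indicator {N..N+n} x * (\<bar>c\<bar>/2) \<le> \<bar>f x\<bar>"
        using N[of x] abs_triangle_ineq3[of "f x" c] c
        by (auto simp: dist_real_def abs_real_def split: split_indicator if_splits)
    next
      have "emeasure lborel {N..N+n} < \<infinity>"
        by (rule emeasure_compact_finite) simp
      then show "integrable lborel (\<lambda>x. indicator {N..N+n} x * (\<bar>c\<bar>/2))"
        by (intro integrable_mult_left) auto
    qed (use int in auto)
    then show ?thesis using that by simp
  qed
  define K where "K = (\<integral>x. \<bar>f x\<bar> \<partial>lborel)"
  have "K \<ge> 0" by (simp add: K_def)
  \<comment> \<open>This value of \<open>n\<close> turns the left side of \<open>bound\<close> into
    \<open>K + 1\<close>.\<close>
  have "(2 * (K + 1) / \<bar>c\<bar>) * (\<bar>c\<bar>/2) \<le> K"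
    unfolding K_def by (rule bound) (simp add: add_nonneg_nonneg)
  then show False using c by (simp add: field_simps)
qed

lemma integrable_tendsto_at_bot_zero:
  fixes f :: "real \<Rightarrow> real"
  assumes int: "integrable lborel f" and lim: "(f \<longlongrightarrow> c) at_bot"
  shows "c = 0"
proof (rule integrable_tendsto_at_top_zero)
  show "integrable lborel (\<lambda>x. f (- x))"
    using lborel_integrable_real_affine[OF int, of "-1" 0] by simp
  show "((\<lambda>x. f (- x)) \<longlongrightarrow> c) at_top"
    using lim by (simp add: filterlim_at_bot_mirror)
qed

text \<open>Any antiderivative \<open>F\<close> satisfies the fundamental theorem on
  \<open>{a..b}\<close>. Letting \<open>a\<close> tend to minus infinity shows that \<open>F\<close>
  converges there, and the improper integral is \<open>F\<close> minus that limit.\<close>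

lemma LBINT_atMost_antiderivative:
  fixes g :: "real \<Rightarrow> real"
  assumes cont: "\<And>x. isCont g x" and int: "integrable lborel g"
  shows "((\<lambda>x. LBINT y:{..x}. g y) has_real_derivative g x) (at x)"
    and "((\<lambda>x. LBINT y:{..x}. g y) \<longlongrightarrow> 0) at_bot"
    and "((\<lambda>x. LBINT y:{..x}. g y) \<longlongrightarrow> (\<integral>y. g y \<partial>lborel)) at_top"
proof -
  obtain F where F: "\<And>x. (F has_real_derivative g x) (at x)"
    using einterval_antiderivative[of "-\<infinity>" "\<infinity>" g] cont
    by (auto simp: has_real_derivative_iff_has_vector_derivative)
  have si: "set_integrable lborel A g" if "A \<in> sets borel" for A
    using int that unfolding set_integrable_def
    by (intro integrable_mult_indicator) auto
  have Icc: "(LBINT y:{a..b}. g y) = F b - F a" if "a \<le> b" for a b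
    using integral_FTC_Icc_real[of a b F g] F cont that
    by (simp add: set_lebesgue_integral_def mult.commute)
  have lim: "(F \<longlongrightarrow> F b - (LBINT y:{..b}. g y)) at_bot" for b
  proof -
    have "((\<lambda>a. LBINT y:{a..b}. g y) \<longlongrightarrow> (LBINT y:{..b}. g y)) at_bot"
      by (intro tendsto_set_lebesgue_integral_at_bot si) auto
    then have "((\<lambda>a. F b - (LBINT y:{a..b}. g y)) \<longlongrightarrow> F b - (LBINT y:{..b}. g y)) at_bot"
      by (intro tendsto_intros)
    moreover have "eventually (\<lambda>a. F b - (LBINT y:{a..b}. g y) = F a) at_bot"
      using eventually_le_at_bot[of b] by eventually_elim (simp add: Icc)
    ultimately show ?thesis by (blast intro: Lim_transform_eventually)
  qed
  \<comment> \<open>The limit of \<open>F\<close> at minus infinity. The base point 0 is arbitrary: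
    by \<open>lim\<close> every \<open>b\<close> yields a limit of the same function.\<close>
  define L where "L = F 0 - (LBINT y:{..0}. g y)"
  have L: "(LBINT y:{..b}. g y) = F b - L" for b
    using tendsto_unique[OF _ lim[of b] lim[of 0]] by (simp add: L_def trivial_limit_at_bot_linorder)
  show "((\<lambda>x. LBINT y:{..x}. g y) has_real_derivative g x) (at x)"
    unfolding L by (auto intro!: derivative_eq_intros F)
  show "((\<lambda>x. LBINT y:{..x}. g y) \<longlongrightarrow> 0) at_bot"
    unfolding L using tendsto_diff[OF lim[of 0] tendsto_const[of L]] by (simp add: L_def)
  show "((\<lambda>x. LBINT y:{..x}. g y) \<longlongrightarrow> (\<integral>y. g y \<partial>lborel)) at_top"
    using tendsto_integral_at_top[of lborel g] int by (simp add: set_lebesgue_integral_def)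
qed

lemma eq_LBINT_atMost:
  fixes f g :: "real \<Rightarrow> real"
  assumes der: "\<And>x. (f has_real_derivative g x) (at x)"
    and cont: "\<And>x. isCont g x" and int: "integrable lborel g"
    and lim: "(f \<longlongrightarrow> 0) at_bot"
  shows "f x = (LBINT y:{..x}. g y)"
proof -
  let ?h = "\<lambda>x. f x - (LBINT y:{..x}. g y)"
  have "(?h has_real_derivative 0) (at x)" for x
    using DERIV_diff[OF der[of x] LBINT_atMost_antiderivative(1)[OF cont int, of x]] by simp
  then have const: "(\<lambda>y. ?h y) = (\<lambda>y. ?h x)"
    using DERIV_isconst_all by blast
  have "((\<lambda>y. ?h y) \<longlongrightarrow> 0) at_bot"
    using tendsto_diff[OF lim LBINT_atMost_antiderivative(2)[OF cont int]] by simp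
  then have "((\<lambda>y::real. ?h x) \<longlongrightarrow> 0) at_bot" by (subst (asm) const)
  then show ?thesis by (simp add: tendsto_const_iff trivial_limit_at_bot_linorder)
qed

text \<open>An integrable derivative forces limits at both ends, and integrability of
  \<open>f\<close> makes both of them 0. The third conclusion stands in for integration by parts
  throughout: boundary terms are integrals of derivatives.\<close>

lemma integrable_deriv_tendsto_zero:
  fixes f g :: "real \<Rightarrow> real"
  assumes der: "\<And>x. (f has_real_derivative g x) (at x)"
    and cont: "\<And>x. isCont g x" and int: "integrable lborel g" "integrable lborel f"
  shows "(f \<longlongrightarrow> 0) at_bot" "(f \<longlongrightarrow> 0) at_top" "(\<integral>x. g x \<partial>lborel) = 0"
proof -
  define I where "I = (\<lambda>x. LBINT y:{..x}. g y)"
  note I = LBINT_atMost_antiderivative[OF cont int(1), folded I_def]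
  have "((\<lambda>x. f x - I x) has_real_derivative 0) (at x)" for x
    using DERIV_diff[OF der[of x] I(1)[of x]] by simp
  then have const: "f x - I x = f 0 - I 0" for x by (rule DERIV_isconst_all[rule_format])
  define c where "c = f 0 - I 0"
  have f: "f = (\<lambda>x. I x + c)" using const by (auto simp: fun_eq_iff c_def algebra_simps)
  have "(f \<longlongrightarrow> 0 + c) at_bot"
    unfolding f by (intro tendsto_intros I)
  then have "0 + c = 0" by (rule integrable_tendsto_at_bot_zero[OF int(2)])
  then have fI: "f = I" unfolding f by simp
  show "(f \<longlongrightarrow> 0) at_bot" using I(2) fI by simp
  show "(\<integral>x. g x \<partial>lborel) = 0"
    by (rule integrable_tendsto_at_top_zero[OF int(2)]) (use I(3) fI in simp)
  then show "(f \<longlongrightarrow> 0) at_top" using I(3) fI by simp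
qed

section \<open>Smooth functions with controlled derivatives\<close>

text \<open>A common form for the three spaces \<open>Aspace k\<close> and for the smooth functions
  with bounded derivatives, so that closure properties are proved once for a generic
  \<open>P\<close>.\<close>

definition smooth_with :: "((real \<Rightarrow> real) \<Rightarrow> bool) \<Rightarrow> (real \<Rightarrow> real) set" where
  "smooth_with P = {f. smooth1 f \<and> (\<forall>j. P ((deriv ^^ j) f))}"

text \<open>A set stable under \<open>deriv\<close> contains all iterated derivatives of its
  members. Exhibiting such a set replaces explicit formulas for higher derivatives.\<close>

lemma smooth_with_coinduct:
  assumes "f \<in> S"
    and step: "\<And>f. f \<in> S \<Longrightarrow> (\<forall>x. f differentiable (at x)) \<and> deriv f \<in> S \<and> P f"
  shows "f \<in> smooth_with P"
proof -
  have "(deriv ^^ j) f \<in> S" for j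
    by (induction j) (use assms in auto)
  then show ?thesis
    using step by (auto simp: smooth_with_def smooth1_def)
qed

lemma smooth_withD:
  assumes "f \<in> smooth_with P"
  shows "f differentiable (at x)" "deriv f \<in> smooth_with P" "P f"
proof -
  have D: "((deriv ^^ j) f) differentiable (at x)" "P ((deriv ^^ j) f)" for j x
    using assms by (auto simp: smooth_with_def smooth1_def)
  show "f differentiable (at x)" "P f" using D[of 0] by auto
  have "(deriv ^^ j) (deriv f) = (deriv ^^ Suc j) f" for j
    by (simp add: funpow_swap1)
  then show "deriv f \<in> smooth_with P"
    using D[of "Suc _"] by (simp only: smooth_with_def smooth1_def mem_Collect_eq) simp
qed

lemma smooth_with_DERIV:
  "f \<in> smooth_with P \<Longrightarrow> (f has_real_derivative deriv f x) (at x)"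
  using smooth_withD(1) by (simp add: DERIV_deriv_iff_real_differentiable)

lemma smooth_with_isCont: "f \<in> smooth_with P \<Longrightarrow> isCont f x"
  using smooth_with_DERIV by (blast intro: DERIV_isCont)

lemma smooth_with_borel: "f \<in> smooth_with P \<Longrightarrow> f \<in> borel_measurable borel"
  by (intro borel_measurable_continuous_onI continuous_at_imp_continuous_on ballI smooth_with_isCont)

lemma smooth_with_intro:
  assumes "\<And>x. (f has_real_derivative g x) (at x)" "g \<in> smooth_with P" "P f"
  shows "f \<in> smooth_with P"
proof (rule smooth_with_coinduct[where S = "insert f (smooth_with P)"])
  fix h assume h: "h \<in> insert f (smooth_with P)"
  have "deriv f = g" using assms(1) by (auto intro: DERIV_imp_deriv)
  moreover have "f differentiable (at x)" for x
    using assms(1) by (auto simp: real_differentiable_def)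
  ultimately show "(\<forall>x. h differentiable (at x)) \<and> deriv h \<in> insert f (smooth_with P) \<and> P h"
    using h assms(2,3) smooth_withD[of h P] by auto
qed auto

lemma smooth_with_mono:
  assumes "f \<in> smooth_with P" "\<And>f. f \<in> smooth_with P \<Longrightarrow> Q f"
  shows "f \<in> smooth_with Q"
  using assms(1) by (rule smooth_with_coinduct) (simp add: assms(2) smooth_withD(1,2)[where P = P])

lemma smooth_with_add:
  assumes f: "f \<in> smooth_with P" and g: "g \<in> smooth_with P"
    and add: "\<And>f g. P f \<Longrightarrow> P g \<Longrightarrow> P (\<lambda>x. f x + g x)"
  shows "(\<lambda>x. f x + g x) \<in> smooth_with P"
proof (rule smooth_with_coinduct[where S = "{(\<lambda>x. f x + g x) | f g. f \<in> smooth_with P \<and> g \<in> smooth_with P}"])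
  show "(\<lambda>x. f x + g x) \<in> {(\<lambda>x. f x + g x) | f g. f \<in> smooth_with P \<and> g \<in> smooth_with P}"
    using f g by blast
next
  fix h assume "h \<in> {(\<lambda>x. f x + g x) | f g. f \<in> smooth_with P \<and> g \<in> smooth_with P}"
  then obtain f g where h: "h = (\<lambda>x. f x + g x)" and f: "f \<in> smooth_with P" and g: "g \<in> smooth_with P"
    by blast
  have D: "(h has_real_derivative deriv f x + deriv g x) (at x)" for x
    unfolding h by (intro DERIV_add smooth_with_DERIV[OF f] smooth_with_DERIV[OF g])
  then have "deriv h = (\<lambda>x. deriv f x + deriv g x)" by (auto intro: DERIV_imp_deriv)
  moreover have "h differentiable (at x)" for x
    using D by (auto simp: real_differentiable_def)
  moreover have "P h" unfolding h by (intro add smooth_withD(3)[OF f] smooth_withD(3)[OF g])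
  ultimately show "(\<forall>x. h differentiable (at x)) \<and>
      deriv h \<in> {(\<lambda>x. f x + g x) | f g. f \<in> smooth_with P \<and> g \<in> smooth_with P} \<and> P h"
    using smooth_withD(2)[OF f] smooth_withD(2)[OF g] by blast
qed

text \<open>Differentiating a product gives a sum of two products, so finite sums of products form
  the stable set needed for coinduction.\<close>

inductive_set product_span :: "(real \<Rightarrow> real) set \<Rightarrow> (real \<Rightarrow> real) set \<Rightarrow> (real \<Rightarrow> real) set"
  for A B where
  prod: "f \<in> A \<Longrightarrow> g \<in> B \<Longrightarrow> (\<lambda>x. f x * g x) \<in> product_span A B"
| add: "h \<in> product_span A B \<Longrightarrow> h' \<in> product_span A B \<Longrightarrow> (\<lambda>x. h x + h' x) \<in> product_span A B"

text \<open>Two factors of different kinds are allowed because the main use is a bounded factor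
  times a decaying one. Induction over the span gives each member the property \<open>R\<close> and
  a derivative in the span.\<close>

lemma smooth_with_mult:
  assumes f: "f \<in> smooth_with P" and g: "g \<in> smooth_with Q"
    and add: "\<And>f g. R f \<Longrightarrow> R g \<Longrightarrow> R (\<lambda>x. f x + g x)"
    and mult: "\<And>f g. f \<in> smooth_with P \<Longrightarrow> g \<in> smooth_with Q \<Longrightarrow> R (\<lambda>x. f x * g x)"
  shows "(\<lambda>x. f x * g x) \<in> smooth_with R"
proof (rule smooth_with_coinduct)
  let ?S = "product_span (smooth_with P) (smooth_with Q)"
  show "(\<lambda>x. f x * g x) \<in> ?S" using f g by (rule product_span.prod)
  fix h assume "h \<in> ?S"
  then have "R h \<and> (\<exists>h'\<in>?S. \<forall>x. (h has_real_derivative h' x) (at x))"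
  proof induction
    case (prod f g)
    have "((\<lambda>x. f x * g x) has_real_derivative f x * deriv g x + deriv f x * g x) (at x)" for x
      by (rule DERIV_mult'[OF smooth_with_DERIV[OF prod(1)] smooth_with_DERIV[OF prod(2)]])
    moreover have "(\<lambda>x. f x * deriv g x + deriv f x * g x) \<in> ?S"
      by (intro product_span.intros prod smooth_withD(2)[OF prod(1)] smooth_withD(2)[OF prod(2)])
    ultimately show ?case
      using mult[OF prod] by (intro conjI bexI[where x = "\<lambda>x. f x * deriv g x + deriv f x * g x"]) auto
  next
    case (add h1 h2)
    then obtain k1 k2 where k: "k1 \<in> ?S" "k2 \<in> ?S"
      "\<And>x. (h1 has_real_derivative k1 x) (at x)" "\<And>x. (h2 has_real_derivative k2 x) (at x)" by blast
    have "((\<lambda>x. h1 x + h2 x) has_real_derivative k1 x + k2 x) (at x)" for x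
      by (intro DERIV_add k)
    moreover have "(\<lambda>x. k1 x + k2 x) \<in> ?S" by (intro product_span.add k)
    ultimately show ?case
      using add assms(3) by (intro conjI bexI[where x = "\<lambda>x. k1 x + k2 x"]) auto
  qed
  then obtain h' where h': "R h" "h' \<in> ?S" "\<And>x. (h has_real_derivative h' x) (at x)" by blast
  then have "deriv h = h'" by (auto intro: DERIV_imp_deriv)
  moreover have "h differentiable (at x)" for x
    using h' by (auto simp: real_differentiable_def)
  ultimately show "(\<forall>x. h differentiable (at x)) \<and> deriv h \<in> ?S \<and> R h" using h' by blast
qed

section \<open>Smooth functions with bounded derivatives of every order\<close>

abbreviation bounded_smooth :: "(real \<Rightarrow> real) set" where
  "bounded_smooth \<equiv> smooth_with (\<lambda>f. bounded (range f))"

lemma bounded_range_iff: "bounded (range f) \<longleftrightarrow> (\<exists>C. \<forall>x. \<bar>f x\<bar> \<le> C)" for f :: "real \<Rightarrow> real"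
  by (auto simp: bounded_iff)

lemma bounded_range_add:
  fixes f g :: "real \<Rightarrow> real"
  assumes "bounded (range f)" "bounded (range g)"
  shows "bounded (range (\<lambda>x. f x + g x))"
  using assms by (rule bounded_plus_comp)

lemma bounded_range_mult:
  fixes f g :: "real \<Rightarrow> real"
  assumes "bounded (range f)" "bounded (range g)"
  shows "bounded (range (\<lambda>x. f x * g x))"
proof -
  obtain C D where C: "\<And>x. \<bar>f x\<bar> \<le> C" and D: "\<And>x. \<bar>g x\<bar> \<le> D"
    using assms unfolding bounded_range_iff by blast
  have "C \<ge> 0" using C[of 0] by linarith
  then have "\<bar>f x * g x\<bar> \<le> C * D" for x
    unfolding abs_mult using C D by (intro mult_mono) auto
  then show ?thesis unfolding bounded_range_iff by blast
qed

lemma bounded_smooth_add: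
  "f \<in> bounded_smooth \<Longrightarrow> g \<in> bounded_smooth \<Longrightarrow> (\<lambda>x. f x + g x) \<in> bounded_smooth"
  by (erule smooth_with_add, assumption, erule bounded_range_add)

lemma bounded_smooth_mult:
  "f \<in> bounded_smooth \<Longrightarrow> g \<in> bounded_smooth \<Longrightarrow> (\<lambda>x. f x * g x) \<in> bounded_smooth"
  by (erule smooth_with_mult, assumption, erule bounded_range_add)
    (auto dest!: smooth_withD(3) intro: bounded_range_mult)

lemma bounded_smooth_const: "(\<lambda>_. c) \<in> bounded_smooth"
proof -
  have "(\<lambda>_. 0::real) \<in> bounded_smooth"
    by (rule smooth_with_coinduct[where S = "{\<lambda>_. 0}"]) auto
  then show ?thesis by (rule smooth_with_intro[rotated]) (simp_all add: image_def)
qed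

text \<open>The quotients \<open>b / p ^ n\<close> with \<open>b\<close> in
  \<open>bounded_smooth\<close> are stable under differentiation, and the lower bound
  \<open>c\<close> keeps each of them bounded.\<close>

lemma bounded_smooth_inverse:
  assumes p: "p \<in> bounded_smooth" and c: "c > 0" and pc: "\<And>x. p x \<ge> c"
  shows "(\<lambda>x. 1 / p x) \<in> bounded_smooth"
proof (rule smooth_with_coinduct)
  let ?S = "{(\<lambda>x. b x / p x ^ n) | n b. b \<in> bounded_smooth}"
  show "(\<lambda>x. 1 / p x) \<in> ?S"
    using bounded_smooth_const[of 1] by (intro CollectI exI[of _ 1] exI[of _ "\<lambda>_. 1"]) simp
  fix h assume "h \<in> ?S"
  then obtain n b where h: "h = (\<lambda>x. b x / p x ^ n)" and b: "b \<in> bounded_smooth" by blast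
  have pos: "p x > 0" for x using c pc[of x] by linarith
  let ?d = "\<lambda>x. deriv b x * p x + (- real n) * (deriv p x * b x)"
  have d: "?d \<in> bounded_smooth"
    by (intro bounded_smooth_add bounded_smooth_mult bounded_smooth_const p b smooth_withD(2)[OF p] smooth_withD(2)[OF b])
  have D: "(h has_real_derivative ?d x / p x ^ Suc n) (at x)" for x
  proof -
    have "(h has_real_derivative (deriv b x * p x ^ n - b x * (real n * (deriv p x * p x ^ (n - Suc 0)))) / (p x ^ n * p x ^ n)) (at x)"
      unfolding h using pos[of x]
      by (intro DERIV_divide smooth_with_DERIV[OF b] DERIV_power[OF smooth_with_DERIV[OF p]]) auto
    moreover have "(deriv b x * p x ^ n - b x * (real n * (deriv p x * p x ^ (n - Suc 0)))) / (p x ^ n * p x ^ n)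
        = ?d x / p x ^ Suc n"
      \<comment> \<open>For \<open>n = 0\<close> the truncated exponent \<open>n - Suc 0\<close> is
        harmless, since its term carries the factor \<open>real n\<close>.\<close>
      using pos[of x] by (cases n) (auto simp: field_simps)
    ultimately show ?thesis by simp
  qed
  then have "deriv h = (\<lambda>x. ?d x / p x ^ Suc n)" by (auto intro: DERIV_imp_deriv)
  then have "deriv h \<in> ?S" using d by (intro CollectI exI[of _ "Suc n"] exI[of _ ?d]) simp
  moreover have "h differentiable (at x)" for x
    using D[of x] by (auto simp: real_differentiable_def)
  moreover have "bounded (range h)"
  proof -
    have "bounded (range (\<lambda>x. 1 / p x ^ n))"
      unfolding bounded_range_iff
    proof (intro exI allI)
      fix x show "\<bar>1 / p x ^ n\<bar> \<le> 1 / c ^ n"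
        using c pc[of x] pos[of x] by (auto intro!: frac_le power_mono)
    qed
    from bounded_range_mult[OF smooth_withD(3)[OF b] this] show ?thesis unfolding h by simp
  qed
  ultimately show "(\<forall>x. h differentiable (at x)) \<and> deriv h \<in> ?S \<and> bounded (range h)" by blast
qed

section \<open>The function spaces\<close>

definition decay :: "space_kind \<Rightarrow> (real \<Rightarrow> real) \<Rightarrow> bool" where
  "decay k f = (case k of
      CompactSupp \<Rightarrow> bounded {x. f x \<noteq> 0}
    | Schwartz \<Rightarrow> \<forall>n. bounded (range (\<lambda>x. \<bar>x\<bar> ^ n * f x))
    | W_inf_1 \<Rightarrow> integrable lborel f)"

lemma decay_add:
  assumes "decay k f" "decay k g"
  shows "decay k (\<lambda>x. f x + g x)"
proof (cases k)
  case CompactSupp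
  have "{x. f x + g x \<noteq> 0} \<subseteq> {x. f x \<noteq> 0} \<union> {x. g x \<noteq> 0}" by auto
  then show ?thesis
    using assms bounded_subset[OF bounded_Un[THEN iffD2]] by (auto simp: decay_def CompactSupp)
next
  case Schwartz
  then show ?thesis
    using assms bounded_range_add by (auto simp: decay_def distrib_left)
next
  case W_inf_1
  then show ?thesis using assms by (auto simp: decay_def)
qed

lemma decay_bounded_mult:
  assumes f: "bounded (range f)" "f \<in> borel_measurable borel" and g: "decay k g"
  shows "decay k (\<lambda>x. f x * g x)"
proof (cases k)
  case CompactSupp
  have "{x. f x * g x \<noteq> 0} \<subseteq> {x. g x \<noteq> 0}" by auto
  then show ?thesis
    using g bounded_subset by (auto simp: decay_def CompactSupp)
next
  case Schwartz
  show ?thesis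
    unfolding decay_def Schwartz space_kind.case
  proof
    fix n
    have "bounded (range (\<lambda>x. f x * (\<bar>x\<bar> ^ n * g x)))"
      by (rule bounded_range_mult[OF f(1)]) (use g in \<open>simp add: decay_def Schwartz\<close>)
    then show "bounded (range (\<lambda>x. \<bar>x\<bar> ^ n * (f x * g x)))"
      by (simp add: mult.left_commute)
  qed
next
  case W_inf_1
  obtain C where C: "\<And>x. \<bar>f x\<bar> \<le> C" using f unfolding bounded_range_iff by blast
  have int: "integrable lborel g" using g by (simp add: decay_def W_inf_1)
  have "integrable lborel (\<lambda>x. f x * g x)"
  proof (rule Bochner_Integration.integrable_bound)
    show "integrable lborel (\<lambda>x. C * g x)" using int by simp
    show "(\<lambda>x. f x * g x) \<in> borel_measurable lborel" using f int by simp
    have "\<bar>f x\<bar> * \<bar>g x\<bar> \<le> \<bar>C\<bar> * \<bar>g x\<bar>" for x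
      using C[of x] by (intro mult_right_mono) auto
    then show "AE x in lborel. norm (f x * g x) \<le> norm (C * g x)" by (simp add: abs_mult)
  qed
  then show ?thesis by (simp add: decay_def W_inf_1)
qed

text \<open>Off the closure of the support \<open>f\<close> vanishes on a whole neighbourhood, so
  its derivative vanishes there too.\<close>

lemma bounded_support_deriv:
  fixes f :: "real \<Rightarrow> real"
  assumes "bounded {x. f x \<noteq> 0}"
  shows "bounded {x. deriv f x \<noteq> 0}"
proof -
  let ?S = "{x. f x \<noteq> 0}"
  have "deriv f x = 0" if "x \<notin> closure ?S" for x
  proof -
    have "(f has_real_derivative 0) (at x)"
    proof (rule has_field_derivative_transform_within_open)
      show "((\<lambda>_. 0) has_real_derivative 0) (at x)" by simp
      show "open (- closure ?S)" by (intro open_Compl closed_closure)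
      show "0 = f y" if "y \<in> - closure ?S" for y
        using that closure_subset[of ?S] by auto
    qed (use that in auto)
    then show ?thesis by (rule DERIV_imp_deriv)
  qed
  then have "{x. deriv f x \<noteq> 0} \<subseteq> closure ?S" by auto
  then show ?thesis using assms bounded_closure bounded_subset by blast
qed

text \<open>Only \<open>CompactSupp\<close> needs an argument: its definition restricts the support
  of \<open>f\<close> alone, and the derivatives inherit the restriction.\<close>

lemma Aspace_eq: "Aspace k = smooth_with (decay k)"
proof (cases k)
  case CompactSupp
  show ?thesis
  proof (intro set_eqI iffI)
    fix f assume f: "f \<in> Aspace k"
    have "bounded {x. (deriv ^^ j) f x \<noteq> 0}" for j
      using f by (induction j) (auto simp: Aspace_def CompactSupp intro: bounded_support_deriv)
    then show "f \<in> smooth_with (decay k)"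
      using f by (simp add: Aspace_def smooth_with_def CompactSupp decay_def)
  next
    fix f assume "f \<in> smooth_with (decay k)"
    then have "smooth1 f" "decay k ((deriv ^^ 0) f)"
      unfolding smooth_with_def by blast+
    then show "f \<in> Aspace k"
      by (simp add: Aspace_def CompactSupp decay_def)
  qed
qed (auto simp: Aspace_def smooth_with_def decay_def)

lemmas Aspace_DERIV = smooth_with_DERIV[where P = "decay k" for k, folded Aspace_eq]
lemmas Aspace_isCont = smooth_with_isCont[where P = "decay k" for k, folded Aspace_eq]
lemmas Aspace_deriv = smooth_withD(2)[where P = "decay k" for k, folded Aspace_eq]

lemmas Aspace_decay = smooth_withD(3)[where P = "decay k" for k, folded Aspace_eq]

lemma decay_integrable:
  assumes cont: "\<And>x. isCont f x" and "decay k f"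
  shows "integrable lborel f"
proof (cases k)
  case CompactSupp
  then obtain R where R: "\<And>x. f x \<noteq> 0 \<Longrightarrow> \<bar>x\<bar> \<le> R"
    using assms by (auto simp: decay_def bounded_iff)
  have "f = (\<lambda>x. indicator {-R..R} x *\<^sub>R f x)"
    using R by (force simp: indicator_def abs_le_iff)
  moreover have "integrable lborel (\<lambda>x. indicator {-R..R} x *\<^sub>R f x)"
    by (intro borel_integrable_compact continuous_at_imp_continuous_on ballI cont) auto
  ultimately show ?thesis by simp
next
  case Schwartz
  then have "bounded (range (\<lambda>x. \<bar>x\<bar> ^ n * f x))" for n
    using assms by (simp add: decay_def)
  \<comment> \<open>The weights 0 and 2 together dominate \<open>f\<close> by a multiple of the
    integrable function \<open>1 / (1 + x^2)\<close>.\<close>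
  from this[of 0] this[of 2] have "bounded (range f)" "bounded (range (\<lambda>x. x^2 * f x))" by auto
  then obtain C D where CD: "\<And>x. \<bar>f x\<bar> \<le> C" "\<And>x. \<bar>x^2 * f x\<bar> \<le> D"
    unfolding bounded_range_iff by blast
  have "integrable lborel (\<lambda>x::real. inverse (1 + x^2))"
    using integrable_inverse_1_plus_square by (simp add: set_integrable_def einterval_def)
  then show ?thesis
  proof (rule Bochner_Integration.integrable_bound[OF integrable_mult_right])
    show "f \<in> borel_measurable lborel"
      using cont by (simp add: borel_measurable_continuous_onI continuous_at_imp_continuous_on)
    have "\<bar>f x\<bar> \<le> (C + D) * inverse (1 + x^2)" for x
    proof -
      have "\<bar>f x\<bar> * (1 + x^2) \<le> C + D"
        using CD[of x] by (simp add: abs_mult algebra_simps)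
      then show ?thesis
        by (simp add: field_simps add_pos_nonneg)
    qed
    then show "AE x in lborel. norm (f x) \<le> norm ((C + D) * inverse (1 + x^2))"
      by (intro AE_I2) (metis real_norm_def abs_ge_self order_trans)
  qed
next
  case W_inf_1
  then show ?thesis using assms by (simp add: decay_def)
qed

lemma Aspace_integrable:
  assumes "f \<in> Aspace k"
  shows "integrable lborel f"
  by (rule decay_integrable[OF Aspace_isCont[OF assms] Aspace_decay[OF assms]])

lemma Aspace_limits:
  assumes f: "f \<in> Aspace k"
  shows "(f \<longlongrightarrow> 0) at_bot" "(f \<longlongrightarrow> 0) at_top" "(\<integral>x. deriv f x \<partial>lborel) = 0"
  using integrable_deriv_tendsto_zero[OF Aspace_DERIV[OF f] Aspace_isCont[OF Aspace_deriv[OF f]]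
      Aspace_integrable[OF Aspace_deriv[OF f]] Aspace_integrable[OF f]] .

text \<open>Membership becomes a statement about the derivative and the limit at minus infinity, so
  closure properties follow by differentiation without handling integrals.\<close>

lemma A1space_iff:
  "X \<in> A1space k \<longleftrightarrow> (\<exists>g\<in>Aspace k. (\<forall>x. (X has_real_derivative g x) (at x)) \<and> (X \<longlongrightarrow> 0) at_bot)"
proof
  assume "X \<in> A1space k"
  then obtain g where g: "g \<in> Aspace k" and X: "X = (\<lambda>x. LBINT y:{..x}. g y)"
    by (auto simp: A1space_def)
  show "\<exists>g\<in>Aspace k. (\<forall>x. (X has_real_derivative g x) (at x)) \<and> (X \<longlongrightarrow> 0) at_bot"
    unfolding X using LBINT_atMost_antiderivative(1,2)[OF Aspace_isCont[OF g] Aspace_integrable[OF g]] g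
    by blast
next
  assume "\<exists>g\<in>Aspace k. (\<forall>x. (X has_real_derivative g x) (at x)) \<and> (X \<longlongrightarrow> 0) at_bot"
  then obtain g where g: "g \<in> Aspace k" and X: "\<And>x. (X has_real_derivative g x) (at x)"
    "(X \<longlongrightarrow> 0) at_bot" by blast
  have "X = (\<lambda>x. LBINT y:{..x}. g y)"
    using eq_LBINT_atMost[OF X(1) Aspace_isCont[OF g] Aspace_integrable[OF g] X(2)] by blast
  then show "X \<in> A1space k" using g by (auto simp: A1space_def)
qed

lemma A1space_intro:
  "\<lbrakk>\<And>x. (X has_real_derivative g x) (at x); g \<in> Aspace k; (X \<longlongrightarrow> 0) at_bot\<rbrakk> \<Longrightarrow> X \<in> A1space k"
  by (auto simp: A1space_iff)

lemma A1spaceD: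
  assumes "X \<in> A1space k"
  shows "deriv X \<in> Aspace k" "(X has_real_derivative deriv X x) (at x)" "(X \<longlongrightarrow> 0) at_bot"
proof -
  obtain g where g: "g \<in> Aspace k" "\<And>x. (X has_real_derivative g x) (at x)" "(X \<longlongrightarrow> 0) at_bot"
    using assms by (auto simp: A1space_iff)
  then have "deriv X = g" by (auto intro: DERIV_imp_deriv)
  with g show "deriv X \<in> Aspace k" "(X has_real_derivative deriv X x) (at x)" "(X \<longlongrightarrow> 0) at_bot"
    by auto
qed

text \<open>An element of \<open>Aspace k\<close> vanishes at minus infinity, hence is the integral
  of its own derivative. This makes results on \<open>A1space k\<close> available for part
  (iii).\<close>

lemma Aspace_subset_A1space: "f \<in> Aspace k \<Longrightarrow> f \<in> A1space k"
  by (intro A1space_intro[where g = "deriv f"] Aspace_DERIV Aspace_deriv Aspace_limits)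

lemma A1space_bounded:
  assumes "X \<in> A1space k"
  shows "bounded (range X)"
proof -
  obtain g where g: "g \<in> Aspace k" and X: "X = (\<lambda>x. LBINT y:{..x}. g y)"
    using assms by (auto simp: A1space_def)
  have "\<bar>X x\<bar> \<le> (\<integral>y. \<bar>g y\<bar> \<partial>lborel)" for x
  proof -
    have int: "integrable lborel (\<lambda>y. indicator {..x} y *\<^sub>R g y)"
      by (intro integrable_mult_indicator Aspace_integrable[OF g]) auto
    have "\<bar>X x\<bar> \<le> (\<integral>y. \<bar>indicator {..x} y *\<^sub>R g y\<bar> \<partial>lborel)"
      unfolding X set_lebesgue_integral_def by (rule integral_abs_bound)
    also have "\<dots> \<le> (\<integral>y. \<bar>g y\<bar> \<partial>lborel)"
      by (intro integral_mono integrable_abs int Aspace_integrable[OF g])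
        (auto split: split_indicator)
    finally show ?thesis .
  qed
  then show ?thesis unfolding bounded_range_iff by blast
qed

text \<open>Every derivative lies in \<open>Aspace k\<close> again, hence in
  \<open>A1space k\<close>, whose members are bounded by the L1 norm of their density.\<close>

lemma Aspace_bounded_smooth:
  assumes "f \<in> Aspace k"
  shows "f \<in> bounded_smooth"
  using assms[unfolded Aspace_eq]
proof (rule smooth_with_mono)
  fix g assume "g \<in> smooth_with (decay k)"
  then show "bounded (range g)"
    by (intro A1space_bounded[of g k] Aspace_subset_A1space) (simp add: Aspace_eq)
qed

lemma A1space_bounded_smooth: "X \<in> A1space k \<Longrightarrow> X \<in> bounded_smooth"
  by (rule smooth_with_intro[OF A1spaceD(2) Aspace_bounded_smooth[OF A1spaceD(1)]])
    (assumption | rule A1space_bounded)+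

lemma Aspace_add: "f \<in> Aspace k \<Longrightarrow> g \<in> Aspace k \<Longrightarrow> (\<lambda>x. f x + g x) \<in> Aspace k"
  unfolding Aspace_eq by (erule smooth_with_add, assumption, erule decay_add)

lemma Aspace_mult:
  assumes "f \<in> bounded_smooth" "g \<in> Aspace k"
  shows "(\<lambda>x. f x * g x) \<in> Aspace k"
  using assms unfolding Aspace_eq
proof (rule smooth_with_mult)
  fix f g assume "f \<in> bounded_smooth" "g \<in> smooth_with (decay k)"
  then show "decay k (\<lambda>x. f x * g x)"
    by (intro decay_bounded_mult smooth_with_borel[of f "\<lambda>f. bounded (range f)"]
        smooth_withD(3)[of f "\<lambda>f. bounded (range f)"] smooth_withD(3)[of g "decay k"])
qed (rule decay_add)

lemma Aspace_scale: "g \<in> Aspace k \<Longrightarrow> (\<lambda>x. c * g x) \<in> Aspace k"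
  by (rule Aspace_mult[OF bounded_smooth_const])

lemma A1space_add: "X \<in> A1space k \<Longrightarrow> Y \<in> A1space k \<Longrightarrow> (\<lambda>x. X x + Y x) \<in> A1space k"
  by (rule A1space_intro[OF DERIV_add[OF A1spaceD(2) A1spaceD(2)]
        Aspace_add[OF A1spaceD(1) A1spaceD(1)] tendsto_add_zero[OF A1spaceD(3) A1spaceD(3)]])

lemma A1space_scale: "X \<in> A1space k \<Longrightarrow> (\<lambda>x. c * X x) \<in> A1space k"
  by (rule A1space_intro[OF DERIV_cmult[OF A1spaceD(2)]
        Aspace_scale[OF A1spaceD(1)] tendsto_mult_right_zero[OF A1spaceD(3)]])

section \<open>The geodesic equation and its obstruction\<close>

text \<open>Positive definiteness of the metric at the identity. The partial integrals of the
  squared derivative lie between 0 and the total 0, so their own derivative vanishes;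
  \<open>f\<close> is then constant, and its limit at minus infinity is 0.\<close>

lemma A1space_eq_zero:
  assumes f: "f \<in> A1space k" and zero: "G_Id f f = 0"
  shows "f = (\<lambda>_. 0)"
proof -
  let ?h = "\<lambda>x. deriv f x * deriv f x"
  have h: "?h \<in> Aspace k"
    by (intro Aspace_mult Aspace_bounded_smooth[of _ k] A1spaceD(1)[OF f])
  note int = Aspace_integrable[OF h]
  have I: "(LBINT y:{..x}. ?h y) = 0" for x
  proof -
    have "(LBINT y:{..x}. ?h y) \<le> (\<integral>y. ?h y \<partial>lborel)"
      unfolding set_lebesgue_integral_def
      by (intro integral_mono integrable_mult_indicator int) (auto split: split_indicator)
    moreover have "0 \<le> (LBINT y:{..x}. ?h y)"
      unfolding set_lebesgue_integral_def by (intro Bochner_Integration.integral_nonneg) auto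
    ultimately show ?thesis using zero by (simp add: G_Id_def)
  qed
  have "deriv f x = 0" for x
    using DERIV_unique[OF LBINT_atMost_antiderivative(1)[OF Aspace_isCont[OF h] int, of x, unfolded I] DERIV_const]
    by simp
  then have "(f has_real_derivative 0) (at x)" for x
    using A1spaceD(2)[OF f, of x] by simp
  then have const: "f = (\<lambda>_. f 0)" using DERIV_isconst_all by blast
  then have "((\<lambda>_::real. f 0) \<longlongrightarrow> 0) at_bot" using A1spaceD(3)[OF f] by metis
  then have "f 0 = 0" by (simp add: tendsto_const_iff trivial_limit_at_bot_linorder)
  then show ?thesis using const by metis
qed

text \<open>Its negative is the right-hand side of the Hunter--Saxton equation. The first term is
  left as the derivative of \<open>X^2 / 2\<close> to agree with the form used in the
  theorem.\<close>

definition hs_field :: "(real \<Rightarrow> real) \<Rightarrow> real \<Rightarrow> real" where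
  "hs_field X x = deriv (\<lambda>y. (X y)\<^sup>2 / 2) x - 1/2 * (LBINT y:{..x}. (deriv X y)\<^sup>2)"

lemma hs_field_eq:
  assumes X: "X \<in> A1space k"
  shows "hs_field X x = X x * deriv X x - 1/2 * (LBINT y:{..x}. (deriv X y)\<^sup>2)"
proof -
  have "((\<lambda>y. (X y)\<^sup>2 / 2) has_real_derivative X x * deriv X x) (at x)"
    by (auto intro!: derivative_eq_intros A1spaceD(2)[OF X])
  then show ?thesis by (simp add: hs_field_def DERIV_imp_deriv)
qed

text \<open>Differentiating \<open>X X' - 1/2 \<integral> X'^2\<close> cancels half of
  \<open>X'^2\<close> and leaves an element of \<open>Aspace k\<close>. The nonzero limit at plus
  infinity is the obstruction behind part (iii).\<close>

lemma
  assumes X: "X \<in> A1space k"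
  shows hs_field_A1space: "hs_field X \<in> A1space k"
    and deriv_hs_field: "deriv (hs_field X) x = X x * deriv (deriv X) x + 1/2 * (deriv X x * deriv X x)"
    and hs_field_at_top: "(X \<longlongrightarrow> 0) at_top \<Longrightarrow> (hs_field X \<longlongrightarrow> - (1/2) * G_Id X X) at_top"
proof -
  let ?g = "deriv X"
  have g: "?g \<in> Aspace k" and DX: "\<And>x. (X has_real_derivative ?g x) (at x)"
    by (rule A1spaceD[OF X])+
  have Dg: "(?g has_real_derivative deriv ?g x) (at x)" for x by (rule Aspace_DERIV[OF g])
  have sq: "(\<lambda>x. (?g x)\<^sup>2) \<in> Aspace k"
    unfolding power2_eq_square by (intro Aspace_mult Aspace_bounded_smooth[OF g] g)
  note I = LBINT_atMost_antiderivative[OF Aspace_isCont[OF sq] Aspace_integrable[OF sq]]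
  let ?F' = "\<lambda>x. X x * deriv ?g x + 1/2 * (?g x * ?g x)"
  have F: "hs_field X = (\<lambda>x. X x * ?g x - 1/2 * (LBINT y:{..x}. (?g y)\<^sup>2))"
    using hs_field_eq[OF X] by blast
  have D: "(hs_field X has_real_derivative ?F' x) (at x)" for x
    unfolding F by (auto intro!: derivative_eq_intros DX Dg I(1)) (simp add: power2_eq_square)
  then show "deriv (hs_field X) x = ?F' x" by (rule DERIV_imp_deriv)
  have "?F' \<in> Aspace k"
    by (intro Aspace_add Aspace_scale Aspace_mult Aspace_bounded_smooth[OF g] g Aspace_deriv
        A1space_bounded_smooth[OF X])
  moreover have "(hs_field X \<longlongrightarrow> 0) at_bot"
  proof -
    have "((\<lambda>x. X x * ?g x - 1/2 * (LBINT y:{..x}. (?g y)\<^sup>2)) \<longlongrightarrow> 0 * 0 - 1/2 * 0) at_bot"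
      by (intro tendsto_intros A1spaceD(3)[OF X] Aspace_limits(1)[OF g] I(2))
    then show ?thesis unfolding F by simp
  qed
  ultimately show "hs_field X \<in> A1space k" by (rule A1space_intro[OF D])
  assume top: "(X \<longlongrightarrow> 0) at_top"
  have "((\<lambda>x. X x * ?g x - 1/2 * (LBINT y:{..x}. (?g y)\<^sup>2)) \<longlongrightarrow> 0 * 0 - 1/2 * (\<integral>y. (?g y)\<^sup>2 \<partial>lborel)) at_top"
    by (intro tendsto_intros top Aspace_limits(2)[OF g] I(3))
  then show "(hs_field X \<longlongrightarrow> - (1/2) * G_Id X X) at_top"
    unfolding F by (simp add: G_Id_def power2_eq_square)
qed

text \<open>The two integrands differ by the derivative of
  \<open>(X' Z / 2 - X Z') X'\<close>, which lies in \<open>\<A>\<close>.\<close>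

lemma ad_star_Gcheck:
  assumes X: "X \<in> A1space k" and Z: "Z \<in> A1space k"
  shows "ad_star X (Gcheck X) Z = Gcheck (hs_field X) Z"
proof -
  note g = A1spaceD(1)[OF X] and h = A1spaceD(1)[OF Z]
  note DX = A1spaceD(2)[OF X] and DZ = A1spaceD(2)[OF Z]
  note Dg = Aspace_DERIV[OF g] and Dh = Aspace_DERIV[OF h]
  define P where "P = (\<lambda>x. (1/2 * (deriv X x * Z x) + (-1) * (X x * deriv Z x)) * deriv X x)"
  \<comment> \<open>The last factor \<open>deriv X\<close> supplies the decay; \<open>X\<close> and
    \<open>Z\<close> themselves are only bounded.\<close>
  have P: "P \<in> Aspace k"
    unfolding P_def
    by (intro Aspace_mult bounded_smooth_add bounded_smooth_mult bounded_smooth_const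
        Aspace_bounded_smooth[OF g] Aspace_bounded_smooth[OF h] A1space_bounded_smooth[OF X] A1space_bounded_smooth[OF Z] g)
  have dP: "deriv P x = (1/2 * (deriv (deriv X) x * Z x + deriv X x * deriv Z x)
      - (deriv X x * deriv Z x + X x * deriv (deriv Z) x)) * deriv X x
      + (1/2 * (deriv X x * Z x) - X x * deriv Z x) * deriv (deriv X) x" for x
    unfolding P_def
    by (rule DERIV_imp_deriv) (auto intro!: derivative_eq_intros DX DZ Dg Dh simp: field_simps)
  have dad: "deriv (ad X Z) x = deriv (deriv X) x * Z x - X x * deriv (deriv Z) x" for x
    unfolding ad_def
    by (rule DERIV_imp_deriv) (auto intro!: derivative_eq_intros DX DZ Dg Dh simp: field_simps)
  have int: "integrable lborel (\<lambda>x. deriv (hs_field X) x * deriv Z x)"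
    by (rule Aspace_integrable[OF Aspace_mult[OF Aspace_bounded_smooth[OF A1spaceD(1)[OF hs_field_A1space[OF X]]] h]])
  have "deriv X x * deriv (ad X Z) x = deriv (hs_field X) x * deriv Z x + deriv P x" for x
    unfolding dad dP deriv_hs_field[OF X] by (simp add: field_simps)
  then have "(\<integral>x. deriv X x * deriv (ad X Z) x \<partial>lborel)
      = (\<integral>x. deriv (hs_field X) x * deriv Z x \<partial>lborel) + (\<integral>x. deriv P x \<partial>lborel)"
    using int Aspace_integrable[OF Aspace_deriv[OF P]] by simp
  then show ?thesis
    using Aspace_limits(3)[OF P] by (simp add: ad_star_def Gcheck_def G_Id_def)
qed

text \<open>The difference \<open>W\<close> of \<open>hs_field X\<close> and a representing
  \<open>Y\<close> must be shown to vanish, although only test functions from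
  \<open>Aspace k\<close> are available and \<open>W\<close> is merely known to lie in
  \<open>A1space k\<close>. Comparing limits at plus infinity then yields
  \<open>G_Id X X = 0\<close>.\<close>

lemma not_in_Gcheck_image_Aspace:
  assumes X: "X \<in> Aspace k" and im: "in_Gcheck_image (Aspace k) (ad_star X (Gcheck X))"
  shows "X = (\<lambda>_. 0)"
proof -
  note X1 = Aspace_subset_A1space[OF X]
  obtain Y where Y: "Y \<in> Aspace k"
    and eq: "\<And>Z. Z \<in> Aspace k \<Longrightarrow> ad_star X (Gcheck X) Z = Gcheck Y Z"
    using im by (auto simp: in_Gcheck_image_def)
  note Y1 = Aspace_subset_A1space[OF Y]
  note F = hs_field_A1space[OF X1]
  define W where "W = (\<lambda>x. hs_field X x + (-1) * Y x)"
  have W: "W \<in> A1space k" unfolding W_def by (intro A1space_add A1space_scale F Y1)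
  define q where "q = deriv W"
  have q: "q \<in> Aspace k" unfolding q_def by (rule A1spaceD(1)[OF W])
  have dW: "q x = deriv (hs_field X) x - deriv Y x" for x
    unfolding q_def W_def
    by (rule DERIV_imp_deriv) (auto intro!: derivative_eq_intros A1spaceD(2)[OF F] A1spaceD(2)[OF Y1])
  have prod: "integrable lborel (\<lambda>x. f x * g x)" if "f \<in> Aspace k" "g \<in> Aspace k" for f g
    by (intro Aspace_integrable[of _ k] Aspace_mult Aspace_bounded_smooth[of _ k] that)
  have orth: "(\<integral>x. q x * deriv Z x \<partial>lborel) = 0" if Z: "Z \<in> Aspace k" for Z
  proof -
    have "Gcheck (hs_field X) Z = Gcheck Y Z"
      using eq[OF Z] ad_star_Gcheck[OF X1 Aspace_subset_A1space[OF Z]] by simp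
    then show ?thesis
      using prod[OF A1spaceD(1)[OF F] Aspace_deriv[OF Z]] prod[OF A1spaceD(1)[OF Y1] Aspace_deriv[OF Z]]
      by (simp add: Gcheck_def G_Id_def dW left_diff_distrib)
  qed
  \<comment> \<open>The admissible test function is \<open>deriv q\<close>: orthogonality gives that
    \<open>q q''\<close> integrates to 0, and adding \<open>q'^2\<close> makes the integrand the
    derivative of \<open>q q'\<close>.\<close>
  note dq = Aspace_deriv[OF q] Aspace_deriv[OF Aspace_deriv[OF q]]
  have "deriv (\<lambda>x. q x * deriv q x) x = q x * deriv (deriv q) x + deriv q x * deriv q x" for x
    by (rule DERIV_imp_deriv[OF DERIV_mult'[OF Aspace_DERIV[OF q] Aspace_DERIV[OF dq(1)]]])
  then have "(\<integral>x. q x * deriv (deriv q) x + deriv q x * deriv q x \<partial>lborel) = 0"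
    using Aspace_limits(3)[OF Aspace_mult[OF Aspace_bounded_smooth[OF q] dq(1)]] by simp
  then have "G_Id q q = 0"
    using orth[OF dq(1)] prod[OF q dq(2)] prod[OF dq(1) dq(1)] by (simp add: G_Id_def)
  \<comment> \<open>Definiteness is used twice: here the energy of \<open>q\<close> is the integral
    of \<open>q'^2\<close>, and next the energy of \<open>W\<close> is the integral of
    \<open>q^2\<close>.\<close>
  then have "q = (\<lambda>_. 0)" by (rule A1space_eq_zero[OF Aspace_subset_A1space[OF q]])
  then have "G_Id W W = 0" by (simp add: G_Id_def q_def[symmetric])
  then have "W = (\<lambda>_. 0)" by (rule A1space_eq_zero[OF W])
  then have "hs_field X = Y" by (auto simp: W_def fun_eq_iff)
  then have "(Y \<longlongrightarrow> - (1/2) * G_Id X X) at_top"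
    using hs_field_at_top[OF X1 Aspace_limits(2)[OF X]] by simp
  then have "- (1/2) * G_Id X X = 0"
    using Aspace_limits(2)[OF Y] tendsto_unique[OF trivial_limit_at_top_linorder] by blast
  then show ?thesis by (intro A1space_eq_zero[OF X1]) simp
qed

section \<open>Diffeomorphisms at bounded distance from the identity\<close>

text \<open>The uniform bound \<open>c\<close> makes \<open>1 / p\<close> a bounded smooth function,
  and the displacement bound makes \<open>x\<close> and \<open>\<phi> x\<close> comparable in size
  near infinity. Together they let composition with the inverse preserve the function
  spaces.\<close>

locale bounded_displacement_diffeo =
  fixes \<phi> p :: "real \<Rightarrow> real" and c C :: real
  assumes DERIV_phi: "(\<phi> has_real_derivative p x) (at x)"
    and p_smooth: "p \<in> bounded_smooth"
    and c_pos: "0 < c" and c_le: "c \<le> p x"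
    and displacement: "\<bar>\<phi> x - x\<bar> \<le> C"
begin

lemma p_pos: "0 < p x"
  using c_pos c_le[of x] by linarith

lemma strict_mono_phi: "x < y \<Longrightarrow> \<phi> x < \<phi> y"
  using DERIV_phi p_pos by (blast intro: DERIV_pos_imp_increasing)

lemma isCont_phi: "isCont \<phi> x"
  using DERIV_phi by (rule DERIV_isCont)

lemma bij_phi: "bij \<phi>"
proof (rule bijI)
  show "inj \<phi>"
    by (rule linorder_injI) (use strict_mono_phi in fastforce)
  show "surj \<phi>"
    unfolding surj_def
  proof
    \<comment> \<open>The displacement bound traps \<open>y\<close> between the values of
      \<open>\<phi>\<close> at \<open>y - C\<close> and \<open>y + C\<close>.\<close>
    fix y
    have "\<phi> (y - C) \<le> y" "y \<le> \<phi> (y + C)"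
      using displacement[of "y - C"] displacement[of "y + C"] by linarith+
    moreover have "y - C \<le> y + C" using displacement[of 0] by linarith
    ultimately show "\<exists>x. y = \<phi> x"
      using IVT[of \<phi> "y - C" y "y + C"] isCont_phi by metis
  qed
qed

lemma inv_right: "\<phi> (inv \<phi> y) = y"
  using bij_phi by (simp add: bij_is_surj surj_f_inv_f)

lemma inv_left: "inv \<phi> (\<phi> x) = x"
  using bij_phi by (simp add: bij_is_inj)

lemma inv_displacement: "\<bar>inv \<phi> y - y\<bar> \<le> C"
  using displacement[of "inv \<phi> y"] by (simp add: inv_right abs_minus_commute)

lemma DERIV_inv: "(inv \<phi> has_real_derivative 1 / p (inv \<phi> y)) (at y)"
proof -
  have "isCont (inv \<phi>) (\<phi> (inv \<phi> y))"
    by (rule isCont_inverse_function[of 1]) (auto simp: inv_left isCont_phi)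
  then have "(inv \<phi> has_real_derivative inverse (p (inv \<phi> y))) (at y)"
    using p_pos[of "inv \<phi> y"]
    by (intro DERIV_inverse_function[where f = \<phi> and a = "y - 1" and b = "y + 1"] DERIV_phi)
      (auto simp: inv_right)
  then show ?thesis by (simp add: inverse_eq_divide)
qed

text \<open>Supports move by at most \<open>C\<close>; polynomial weights in \<open>y\<close> are
  dominated by weights in \<open>\<bar>inv \<phi> y\<bar> + C\<close>; integrability follows by the
  change of variables with density \<open>p\<close>.\<close>

lemma decay_compose_inv:
  assumes q: "q \<in> Aspace k"
  shows "decay k (\<lambda>y. q (inv \<phi> y))"
proof (cases k)
  case CompactSupp
  then obtain R where R: "\<And>x. q x \<noteq> 0 \<Longrightarrow> \<bar>x\<bar> \<le> R"
    using Aspace_decay[OF q] by (auto simp: decay_def bounded_iff)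
  have "\<bar>y\<bar> \<le> R + C" if "q (inv \<phi> y) \<noteq> 0" for y
    using R[OF that] inv_displacement[of y] by linarith
  then show ?thesis by (auto simp: decay_def CompactSupp bounded_iff)
next
  case Schwartz
  \<comment> \<open>The extra exponent \<open>m\<close> is generalized because splitting one factor
    \<open>\<bar>x\<bar> + C\<close> raises it by one.\<close>
  have "bounded (range (\<lambda>x. \<bar>x\<bar> ^ m * ((\<bar>x\<bar> + C) ^ n * q x)))" for m n
  proof (induction n arbitrary: m)
    case 0
    show ?case using Aspace_decay[OF q] by (simp add: decay_def Schwartz)
  next
    case (Suc n)
    have "bounded (range (\<lambda>x. C * (\<bar>x\<bar> ^ m * ((\<bar>x\<bar> + C) ^ n * q x))))"
      by (rule bounded_range_mult[OF _ Suc]) (auto simp: bounded_iff)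
    from bounded_range_add[OF Suc[of "Suc m"] this] show ?case
      by (simp add: algebra_simps)
  qed
  then have B: "bounded (range (\<lambda>x. (\<bar>x\<bar> + C) ^ n * q x))" for n
    by (drule_tac x = 0 in meta_spec) simp
  have "bounded (range (\<lambda>y. \<bar>y\<bar> ^ n * q (inv \<phi> y)))" for n
  proof -
    obtain D where D: "\<And>x. \<bar>(\<bar>x\<bar> + C) ^ n * q x\<bar> \<le> D"
      using B[of n] unfolding bounded_range_iff by blast
    have "\<bar>\<bar>y\<bar> ^ n * q (inv \<phi> y)\<bar> \<le> D" for y
    proof -
      have le: "\<bar>y\<bar> \<le> \<bar>inv \<phi> y\<bar> + C" using inv_displacement[of y] by linarith
      have "\<bar>\<bar>y\<bar> ^ n * q (inv \<phi> y)\<bar> = \<bar>y\<bar> ^ n * \<bar>q (inv \<phi> y)\<bar>"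
        by (simp add: abs_mult power_abs)
      also have "\<dots> \<le> (\<bar>inv \<phi> y\<bar> + C) ^ n * \<bar>q (inv \<phi> y)\<bar>"
        using le by (intro mult_right_mono power_mono) auto
      also have "\<dots> \<le> \<bar>(\<bar>inv \<phi> y\<bar> + C) ^ n * q (inv \<phi> y)\<bar>"
        by (simp only: abs_mult) (intro mult_right_mono abs_ge_self abs_ge_zero)
      also have "\<dots> \<le> D" by (rule D)
      finally show ?thesis .
    qed
    then show ?thesis unfolding bounded_range_iff by blast
  qed
  then show ?thesis by (simp add: decay_def Schwartz)
next
  case W_inf_1
  have pq: "integrable lborel (\<lambda>x. p x * q x)"
    by (rule Aspace_integrable[OF Aspace_mult[OF p_smooth q]])
  have meas: "(\<lambda>y. q (inv \<phi> y)) \<in> borel_measurable borel"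
    by (intro borel_measurable_continuous_onI continuous_at_imp_continuous_on ballI
        isCont_o2[OF DERIV_isCont[OF DERIV_inv]] Aspace_isCont[OF q])
  \<comment> \<open>The change of variables is stated for Lebesgue measure, so integrability passes
    to the completion and back.\<close>
  have "integrable lebesgue (\<lambda>x. p x * q x)"
    by (rule integrable_completion[THEN iffD2]) (use pq in auto)
  then have "(\<lambda>x. \<bar>p x\<bar> * (\<lambda>y. q (inv \<phi> y)) (\<phi> x)) absolutely_integrable_on UNIV"
    using p_pos by (simp add: set_integrable_def inv_left less_imp_le)
  then have "(\<lambda>y. q (inv \<phi> y)) absolutely_integrable_on range \<phi>"
    by (subst absolutely_integrable_change_of_variables_1'[where h = p])
      (use DERIV_phi bij_is_inj[OF bij_phi] in auto)
  then have "integrable lebesgue (\<lambda>y. q (inv \<phi> y))"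
    using bij_is_surj[OF bij_phi] by (simp add: set_integrable_def)
  then have "integrable lborel (\<lambda>y. q (inv \<phi> y))"
    by (rule integrable_completion[THEN iffD1, rotated]) (use meas in simp)
  then show ?thesis by (simp add: decay_def W_inf_1)
qed

lemma inverse_p: "(\<lambda>x. 1 / p x) \<in> bounded_smooth"
  using p_smooth c_pos c_le by (rule bounded_smooth_inverse)

lemma DERIV_compose_inv:
  "(q has_real_derivative q') (at (inv \<phi> y)) \<Longrightarrow>
    ((\<lambda>y. q (inv \<phi> y)) has_real_derivative 1 / p (inv \<phi> y) * q') (at y)"
  using DERIV_chain2[OF _ DERIV_inv] by (metis mult.commute)

text \<open>The derivative of \<open>q\<close> composed with the inverse is \<open>q' / p\<close>
  composed with the inverse, and \<open>q' / p\<close> is again in \<open>Aspace k\<close>.\<close>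

lemma Aspace_compose_inv:
  assumes "q \<in> Aspace k"
  shows "(\<lambda>y. q (inv \<phi> y)) \<in> Aspace k"
  unfolding Aspace_eq
proof (rule smooth_with_coinduct[where S = "{(\<lambda>y. q (inv \<phi> y)) | q. q \<in> Aspace k}"])
  show "(\<lambda>y. q (inv \<phi> y)) \<in> {(\<lambda>y. q (inv \<phi> y)) | q. q \<in> Aspace k}"
    by (intro CollectI exI[of _ q] conjI refl assms)
  fix h assume "h \<in> {(\<lambda>y. q (inv \<phi> y)) | q. q \<in> Aspace k}"
  then obtain q where h: "h = (\<lambda>y. q (inv \<phi> y))" and q: "q \<in> Aspace k" by blast
  have D: "(h has_real_derivative (\<lambda>x. 1 / p x * deriv q x) (inv \<phi> y)) (at y)" for y
    unfolding h by (rule DERIV_compose_inv[OF Aspace_DERIV[OF q]])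
  then have "deriv h = (\<lambda>y. (\<lambda>x. 1 / p x * deriv q x) (inv \<phi> y))"
    by (intro ext DERIV_imp_deriv)
  moreover have "(\<lambda>x. 1 / p x * deriv q x) \<in> Aspace k"
    by (rule Aspace_mult[OF inverse_p Aspace_deriv[OF q]])
  ultimately have "deriv h \<in> {(\<lambda>y. q (inv \<phi> y)) | q. q \<in> Aspace k}"
    by (intro CollectI exI[of _ "\<lambda>x. 1 / p x * deriv q x"]) simp
  moreover have "h differentiable (at y)" for y
    using D[of y] by (auto simp: real_differentiable_def)
  moreover have "decay k h" unfolding h by (rule decay_compose_inv[OF q])
  ultimately show "(\<forall>x. h differentiable (at x)) \<and>
      deriv h \<in> {(\<lambda>y. q (inv \<phi> y)) | q. q \<in> Aspace k} \<and> decay k h" by blast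
qed

text \<open>This keeps the right logarithmic derivative of a curve inside the Lie algebra.\<close>

lemma A1space_compose_inv:
  assumes h: "h \<in> A1space k"
  shows "h \<circ> inv \<phi> \<in> A1space k"
  unfolding comp_def
proof (rule A1space_intro)
  show "((\<lambda>y. h (inv \<phi> y)) has_real_derivative (\<lambda>x. 1 / p x * deriv h x) (inv \<phi> y)) (at y)" for y
    by (rule DERIV_compose_inv[OF A1spaceD(2)[OF h]])
  show "(\<lambda>y. (\<lambda>x. 1 / p x * deriv h x) (inv \<phi> y)) \<in> Aspace k"
    by (rule Aspace_compose_inv[OF Aspace_mult[OF inverse_p A1spaceD(1)[OF h]]])
  have "filterlim (inv \<phi>) at_bot at_bot"
    unfolding filterlim_at_bot
  proof
    fix Z
    have "inv \<phi> y \<le> Z" if "y \<le> Z - C" for y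
      using that inv_displacement[of y] by linarith
    then show "eventually (\<lambda>y. inv \<phi> y \<le> Z) at_bot"
      by (rule eventually_mono[OF eventually_le_at_bot[of "Z - C"]])
  qed
  with A1spaceD(3)[OF h] show "((\<lambda>y. h (inv \<phi> y)) \<longlongrightarrow> 0) at_bot"
    by (rule filterlim_compose)
qed

end

lemma DiffA1E:
  assumes "\<phi> \<in> DiffA1 k"
  obtains f where "f \<in> A1space k" "\<phi> = (\<lambda>x. x + f x)" "\<And>x. deriv f x > -1"
  using assms unfolding DiffA1_def by blast

text \<open>The derivative of \<open>f\<close> tends to 0 at both ends, so it stays above -1/2
  outside a compact interval and attains a minimum above -1 inside; hence \<open>1 + deriv f\<close>
  is bounded away from 0.\<close>

lemma DiffA1_diffeo:
  assumes "\<phi> \<in> DiffA1 k"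
  obtains p c C where "bounded_displacement_diffeo \<phi> p c C"
proof -
  obtain f where f: "f \<in> A1space k" and phi: "\<phi> = (\<lambda>x. x + f x)" and gt: "\<And>x. deriv f x > -1"
    using DiffA1E[OF assms] by blast
  note g = A1spaceD(1)[OF f]
  obtain C where C: "\<And>x. \<bar>f x\<bar> \<le> C"
    using A1space_bounded[OF f] unfolding bounded_range_iff by blast
  have "eventually (\<lambda>x. deriv f x > - (1/2)) at_top" "eventually (\<lambda>x. deriv f x > - (1/2)) at_bot"
    using Aspace_limits(1,2)[OF g] by (auto intro: order_tendstoD)
  then obtain a b where ab: "\<And>x. x \<ge> b \<Longrightarrow> deriv f x > - (1/2)" "\<And>x. x \<le> a \<Longrightarrow> deriv f x > - (1/2)"
    by (auto simp: eventually_at_top_linorder eventually_at_bot_linorder)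
  \<comment> \<open>No order between \<open>a\<close> and \<open>b\<close> is known;
    \<open>min\<close> and \<open>max\<close> keep the interval nonempty.\<close>
  have "continuous_on {min a b..max a b} (deriv f)"
    by (intro continuous_at_imp_continuous_on ballI Aspace_isCont[OF g])
  then obtain z where z: "\<And>x. x \<in> {min a b..max a b} \<Longrightarrow> deriv f z \<le> deriv f x"
    using continuous_attains_inf[of "{min a b..max a b}" "deriv f"] by fastforce
  define c where "c = min (1/2) (1 + deriv f z)"
  have c: "c \<le> 1 + deriv f x" for x
  proof (cases "x \<in> {min a b..max a b}")
    case True
    then show ?thesis using z[of x] by (simp add: c_def)
  next
    case False
    then have "x \<le> a \<or> b \<le> x" by auto
    then have "deriv f x > - (1/2)" using ab by blast
    then show ?thesis unfolding c_def by linarith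
  qed
  have "bounded_displacement_diffeo \<phi> (\<lambda>x. 1 + deriv f x) c C"
  proof
    show "(\<phi> has_real_derivative 1 + deriv f x) (at x)" for x
      unfolding phi by (intro DERIV_add DERIV_ident A1spaceD(2)[OF f])
    show "(\<lambda>x. 1 + deriv f x) \<in> bounded_smooth"
      by (intro bounded_smooth_add bounded_smooth_const Aspace_bounded_smooth[OF g])
    show "0 < c" using gt[of z] by (simp add: c_def)
  qed (use c C phi in auto)
  then show thesis by (rule that)
qed

lemma
  assumes "\<phi> \<in> DiffA1 k"
  shows DiffA1_strict_mono: "x < y \<Longrightarrow> \<phi> x < \<phi> y"
    and DiffA1_inv_left: "inv \<phi> (\<phi> x) = x"
    and DiffA1_compose_inv: "h \<in> A1space k \<Longrightarrow> h \<circ> inv \<phi> \<in> A1space k"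
proof -
  obtain p c C where "bounded_displacement_diffeo \<phi> p c C"
    using DiffA1_diffeo[OF assms] .
  then interpret bounded_displacement_diffeo \<phi> p c C .
  show "x < y \<Longrightarrow> \<phi> x < \<phi> y" by (rule strict_mono_phi)
  show "inv \<phi> (\<phi> x) = x" by (rule inv_left)
  show "h \<in> A1space k \<Longrightarrow> h \<circ> inv \<phi> \<in> A1space k" by (rule A1space_compose_inv)
qed

section \<open>Geodesics and geodesic distance\<close>

text \<open>Cauchy--Schwarz on \<open>{a..b}\<close>, obtained by integrating
  \<open>2 m u' - m^2 \<le> u'^2\<close> for the mean slope \<open>m\<close>, the value for which
  the left side integrates to \<open>(u b - u a)^2 / (b - a)\<close>.\<close>

lemma A1space_increment_le:
  assumes u: "u \<in> A1space k" and ab: "a < b"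
  shows "\<bar>u b - u a\<bar> \<le> sqrt (b - a) * sqrt (G_Id u u)"
proof -
  note g = A1spaceD(1)[OF u]
  define m where "m = (u b - u a) / (b - a)"
  let ?f = "\<lambda>x. 2 * m * deriv u x - m\<^sup>2"
  let ?F = "\<lambda>x. 2 * m * u x - m\<^sup>2 * x"
  have DF: "(?F has_real_derivative ?f x) (at x)" for x
    by (auto intro!: derivative_eq_intros A1spaceD(2)[OF u])
  have cf: "isCont ?f x" for x
    by (intro continuous_intros Aspace_isCont[OF g])
  have int: "(\<integral>x. ?f x * indicator {a..b} x \<partial>lborel) = ?F b - ?F a"
    by (rule integral_FTC_Icc_real) (use ab DF cf in auto)
  have "(\<integral>x. ?f x * indicator {a..b} x \<partial>lborel) \<le> (\<integral>x. deriv u x * deriv u x \<partial>lborel)"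
  proof (rule integral_mono)
    show "integrable lborel (\<lambda>x. ?f x * indicator {a..b} x)"
      by (rule borel_integrable_atLeastAtMost) (rule cf)
    show "integrable lborel (\<lambda>x. deriv u x * deriv u x)"
      by (rule Aspace_integrable[OF Aspace_mult[OF Aspace_bounded_smooth[OF g] g]])
    fix x
    have "0 \<le> (deriv u x - m)\<^sup>2" by simp
    then have "?f x \<le> deriv u x * deriv u x" by (simp add: power2_eq_square algebra_simps)
    then show "?f x * indicator {a..b} x \<le> deriv u x * deriv u x"
      by (simp split: split_indicator)
  qed
  then have "?F b - ?F a \<le> G_Id u u" by (simp add: int G_Id_def)
  moreover have "?F b - ?F a = (u b - u a)\<^sup>2 / (b - a)"
  proof -
    have m: "m * (b - a) = u b - u a" using ab by (simp add: m_def)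
    have "?F b - ?F a = 2 * m * (u b - u a) - m * (m * (b - a))"
      by (simp add: power2_eq_square algebra_simps)
    also have "\<dots> = m * (u b - u a)" unfolding m by simp
    finally show ?thesis by (simp add: m_def power2_eq_square)
  qed
  ultimately have "(u b - u a)\<^sup>2 / (b - a) \<le> G_Id u u" by simp
  then have "(u b - u a)\<^sup>2 \<le> (b - a) * G_Id u u"
    using ab by (simp add: pos_divide_le_eq mult.commute)
  then show ?thesis
    by (simp add: real_sqrt_mult[symmetric] real_le_rsqrt)
qed

section \<open>Path length and positivity of the distance\<close>

lemma smooth2_on_DERIV:
  assumes "smooth2_on U f"
  obtains f1 where "smooth2_on U f1"
    "\<And>t x. (t, x) \<in> U \<Longrightarrow> ((\<lambda>s. f (s, x)) has_real_derivative f1 (t, x)) (at t)"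
  using assms
proof cases
  case (1 f1 f2)
  have "((\<lambda>s. f (s, x)) has_real_derivative f1 (t, x)) (at t)" if "(t, x) \<in> U" for t x
  proof -
    have f: "(f has_derivative (\<lambda>(s, y). f1 (t, x) * s + f2 (t, x) * y)) (at (t, x))"
      using 1 that by blast
    \<comment> \<open>The partial derivative in \<open>t\<close> is the total derivative restricted
      to the horizontal line through \<open>x\<close>.\<close>
    have "((\<lambda>s. (s, x)) has_derivative (\<lambda>s. (s, 0))) (at t)"
      by (intro has_derivative_Pair has_derivative_ident has_derivative_const)
    from has_derivative_compose[OF this f]
    have "((\<lambda>s. f (s, x)) has_derivative (\<lambda>s. f1 (t, x) * s)) (at t)" by simp
    then show ?thesis by (simp add: has_field_derivative_def)
  qed
  with 1 show thesis by (intro that[of f1])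
qed

text \<open>The length of a path dominates the variation of \<open>2 \<surd>\<ell>\<close>, where \<open>\<ell>\<close> is the length of the
  moving interval from \<open>phi t \<alpha>\<close> to \<open>phi t \<beta>\<close>: since \<open>\<ell>' = u (phi t \<beta>) - u (phi t \<alpha>)\<close>,
  the increment bound gives \<open>\<bar>\<ell>'\<bar> \<le> \<surd>\<ell> \<cdot> \<surd>G\<close>.\<close>

lemma path_length_ge:
  assumes phi: "phi \<in> smooth_paths k \<phi>0 \<phi>1" and less: "\<alpha> < \<beta>"
  shows "ennreal \<bar>2 * sqrt (\<phi>1 \<beta> - \<phi>1 \<alpha>) - 2 * sqrt (\<phi>0 \<beta> - \<phi>0 \<alpha>)\<bar> \<le> path_length phi"
proof -
  obtain \<epsilon> where eps: "\<epsilon> > 0" and sm: "smooth2_on ({-\<epsilon><..<1+\<epsilon>} \<times> UNIV) (\<lambda>(t, x). phi t x)"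
    and mem: "\<And>t. t \<in> {0..1} \<Longrightarrow> phi t \<in> DiffA1 k" "\<And>t. t \<in> {0..1} \<Longrightarrow> dt phi t \<in> A1space k"
    and ends: "phi 0 = \<phi>0" "phi 1 = \<phi>1"
    using phi by (auto simp: smooth_paths_def)
  \<comment> \<open>Because the domain is open and contains the closed time interval, derivatives at
    times 0 and 1 are two-sided.\<close>
  have inU: "(t, x) \<in> {-\<epsilon><..<1+\<epsilon>} \<times> UNIV" if "t \<in> {0..1}" for t x
    using that eps by auto
  obtain f1 where f1: "smooth2_on ({-\<epsilon><..<1+\<epsilon>} \<times> UNIV) f1"
    and D: "\<And>t x. (t, x) \<in> {-\<epsilon><..<1+\<epsilon>} \<times> UNIV \<Longrightarrow> ((\<lambda>s. phi s x) has_real_derivative f1 (t, x)) (at t)"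
    using smooth2_on_DERIV[OF sm] by auto
  \<comment> \<open>A second time derivative is taken to get continuity of \<open>l'\<close>, as the
    fundamental theorem below requires.\<close>
  obtain f11 where D1: "\<And>t x. (t, x) \<in> {-\<epsilon><..<1+\<epsilon>} \<times> UNIV \<Longrightarrow>
      ((\<lambda>s. f1 (s, x)) has_real_derivative f11 (t, x)) (at t)"
    using smooth2_on_DERIV[OF f1] by blast
  have dt: "dt phi t x = f1 (t, x)" if "t \<in> {0..1}" for t x
    unfolding dt_def by (rule DERIV_imp_deriv[OF D[OF inU[OF that]]])
  define l where "l = (\<lambda>t. phi t \<beta> - phi t \<alpha>)"
  define l' where "l' = (\<lambda>t. f1 (t, \<beta>) - f1 (t, \<alpha>))"
  have mono: "phi t \<alpha> < phi t \<beta>" if t: "t \<in> {0..1}" for t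
    by (rule DiffA1_strict_mono[OF mem(1)[OF t] less])
  have lpos: "0 < l t" if "t \<in> {0..1}" for t using mono[OF that] by (simp add: l_def)
  have Dl: "(l has_real_derivative l' t) (at t)" if "t \<in> {0..1}" for t
    unfolding l_def l'_def by (intro DERIV_diff D inU that)
  have Ds: "((\<lambda>t. 2 * sqrt (l t)) has_real_derivative l' t / sqrt (l t)) (at t)" if "t \<in> {0..1}" for t
  proof -
    have "((\<lambda>t. 2 * sqrt (l t)) has_real_derivative 2 * (inverse (sqrt (l t)) / 2 * l' t)) (at t)"
      by (intro DERIV_cmult DERIV_chain2[where f = sqrt and g = l] DERIV_real_sqrt lpos Dl that)
    moreover have "2 * (inverse (sqrt (l t)) / 2 * l' t) = l' t / sqrt (l t)"
      by (simp add: field_simps)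
    ultimately show ?thesis by metis
  qed
  have cl': "isCont l' t" if "t \<in> {0..1}" for t
    unfolding l'_def by (intro continuous_diff DERIV_isCont[OF D1[OF inU[OF that]]])
  have cs: "isCont (\<lambda>t. l' t / sqrt (l t)) t" if "t \<in> {0..1}" for t
    using lpos[OF that]
    by (intro continuous_divide cl' that continuous_real_sqrt DERIV_isCont[OF Dl]) auto
  have speed: "\<bar>l' t / sqrt (l t)\<bar> \<le> sqrt (G_at (phi t) (dt phi t) (dt phi t))" if t: "t \<in> {0..1}" for t
  proof -
    let ?u = "dt phi t \<circ> inv (phi t)"
    have u: "?u \<in> A1space k" by (rule DiffA1_compose_inv[OF mem(1)[OF t] mem(2)[OF t]])
    have inv: "inv (phi t) (phi t x) = x" for x by (rule DiffA1_inv_left[OF mem(1)[OF t]])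
    have "\<bar>l' t\<bar> \<le> sqrt (l t) * sqrt (G_Id ?u ?u)"
      using A1space_increment_le[OF u mono[OF t]] dt[OF t] by (simp add: inv l_def l'_def)
    then show ?thesis
      using lpos[OF t] by (simp add: G_at_def abs_divide divide_le_eq mult.commute)
  qed
  let ?s = "\<lambda>t. l' t / sqrt (l t) * indicator {0..1} t"
  have "has_bochner_integral lborel ?s (2 * sqrt (l 1) - 2 * sqrt (l 0))"
    by (rule has_bochner_integral_FTC_Icc_real) (use Ds cs in auto)
  then have int: "integrable lborel ?s" and eq: "(\<integral>t. ?s t \<partial>lborel) = 2 * sqrt (l 1) - 2 * sqrt (l 0)"
    by (auto simp: has_bochner_integral_iff)
  have "ennreal \<bar>2 * sqrt (l 1) - 2 * sqrt (l 0)\<bar> \<le> (\<integral>\<^sup>+ t. ennreal (norm (?s t)) \<partial>lborel)"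
    using integral_norm_bound_ennreal[OF int] unfolding eq real_norm_def .
  also have "\<dots> \<le> path_length phi"
    unfolding path_length_def
    using speed by (intro nn_integral_mono) (auto intro!: ennreal_leI split: split_indicator simp del: abs_divide)
  finally show ?thesis by (simp add: l_def ends)
qed

text \<open>Equal increments leave only a translation between the two maps, and the limit 0 of both
  displacements at minus infinity excludes it.\<close>

lemma DiffA1_eqI:
  assumes "\<phi>0 \<in> DiffA1 k" "\<phi>1 \<in> DiffA1 k"
    and eq: "\<And>a b. a < b \<Longrightarrow> \<phi>0 b - \<phi>0 a = \<phi>1 b - \<phi>1 a"
  shows "\<phi>0 = \<phi>1"
proof -
  obtain f0 where f0: "f0 \<in> A1space k" "\<phi>0 = (\<lambda>x. x + f0 x)" using DiffA1E[OF assms(1)] by blast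
  obtain f1 where f1: "f1 \<in> A1space k" "\<phi>1 = (\<lambda>x. x + f1 x)" using DiffA1E[OF assms(2)] by blast
  have const: "f0 x - f1 x = f0 0 - f1 0" for x
    using eq[of x 0] eq[of 0 x] f0 f1 by (cases x "0::real" rule: linorder_cases) auto
  have "((\<lambda>x. f0 x - f1 x) \<longlongrightarrow> 0 - 0) at_bot"
    by (intro tendsto_diff A1spaceD(3)[OF f0(1)] A1spaceD(3)[OF f1(1)])
  then have "((\<lambda>_::real. f0 0 - f1 0) \<longlongrightarrow> 0 - 0) at_bot" by (subst (asm) const)
  then have "f0 0 - f1 0 = 0" by (simp add: tendsto_const_iff trivial_limit_at_bot_linorder)
  then show ?thesis using const f0 f1 by auto
qed

text \<open>The lower bound for the length involves only the endpoints, so it passes to the infimum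
  over paths; it is positive because the square root is injective.\<close>

lemma geodesic_distance_pos:
  assumes "\<phi>0 \<in> DiffA1 k" "\<phi>1 \<in> DiffA1 k" "\<phi>0 \<noteq> \<phi>1"
  shows "geodesic_distance k \<phi>0 \<phi>1 > 0"
proof -
  obtain a b where ab: "a < b" "\<phi>0 b - \<phi>0 a \<noteq> \<phi>1 b - \<phi>1 a"
    using DiffA1_eqI[OF assms(1,2)] assms(3) by blast
  then have "0 < ennreal \<bar>2 * sqrt (\<phi>1 b - \<phi>1 a) - 2 * sqrt (\<phi>0 b - \<phi>0 a)\<bar>" by simp
  also have "\<dots> \<le> geodesic_distance k \<phi>0 \<phi>1"
    unfolding geodesic_distance_def by (intro INF_greatest path_length_ge ab)
  finally show ?thesis .
qed

section \<open>Geodesics as solutions of the Hunter--Saxton equation\<close>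

lemma geodesic_iff_hunter_saxton:
  assumes "smooth_curve k J phi"
  shows "is_geodesic k J phi \<longleftrightarrow> hunter_saxton J (rlog phi)"
proof -
  have "(dt (rlog phi) t \<in> A1space k \<and>
      (\<forall>Z\<in>A1space k. Gcheck (dt (rlog phi) t) Z = - ad_star (rlog phi t) (Gcheck (rlog phi t)) Z))
    \<longleftrightarrow> (\<forall>x. dt (rlog phi) t x = - rlog phi t x * deriv (rlog phi t) x
          + 1/2 * (LBINT z:{..x}. (deriv (rlog phi t) z)\<^sup>2))" (is "?L \<longleftrightarrow> ?R") if t: "t \<in> J" for t
  proof -
    let ?u = "rlog phi t" and ?v = "dt (rlog phi) t"
    have u: "?u \<in> A1space k"
      using assms t unfolding rlog_def smooth_curve_def by (intro DiffA1_compose_inv) auto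
    note F = hs_field_A1space[OF u]
    have R: "?R \<longleftrightarrow> ?v = (\<lambda>x. (-1) * hs_field ?u x)"
      by (simp add: fun_eq_iff hs_field_eq[OF u])
    have prod: "integrable lborel (\<lambda>x. deriv f x * deriv g x)" if "f \<in> A1space k" "g \<in> A1space k" for f g
      by (intro Aspace_integrable[of _ k] Aspace_mult Aspace_bounded_smooth[of _ k] A1spaceD(1) that)
    show ?thesis
      unfolding R
    proof
      assume L: ?L
      then have v: "?v \<in> A1space k" by blast
      \<comment> \<open>The defect of the equation. It lies in \<open>A1space k\<close> itself, so
        it may serve as its own test function, and definiteness makes it vanish.\<close>
      define W where "W = (\<lambda>x. ?v x + hs_field ?u x)"
      have W: "W \<in> A1space k" unfolding W_def by (rule A1space_add[OF v F])
      have dW: "deriv W x = deriv ?v x + deriv (hs_field ?u) x" for x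
        unfolding W_def by (intro DERIV_imp_deriv DERIV_add A1spaceD(2)[OF v] A1spaceD(2)[OF F])
      have "Gcheck ?v W = - Gcheck (hs_field ?u) W"
        using L W ad_star_Gcheck[OF u W] by simp
      moreover have "deriv W x * deriv W x = deriv ?v x * deriv W x + deriv (hs_field ?u) x * deriv W x" for x
        unfolding dW by (rule distrib_right)
      then have "G_Id W W = Gcheck ?v W + Gcheck (hs_field ?u) W"
        using prod[OF v W] prod[OF F W] by (simp add: Gcheck_def G_Id_def)
      ultimately have "G_Id W W = 0" by simp
      then have "W = (\<lambda>_. 0)" by (rule A1space_eq_zero[OF W])
      then show "?v = (\<lambda>x. (-1) * hs_field ?u x)"
        by (simp add: W_def fun_eq_iff add_eq_0_iff2)
    next
      assume v: "?v = (\<lambda>x. (-1) * hs_field ?u x)"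
      have dv: "deriv ?v x = - deriv (hs_field ?u) x" for x
        unfolding v using DERIV_cmult[OF A1spaceD(2)[OF F], of "-1"] by (auto intro: DERIV_imp_deriv)
      have "?v \<in> A1space k" unfolding v by (rule A1space_scale[OF F])
      then show ?L
        using ad_star_Gcheck[OF u] by (auto simp: Gcheck_def G_Id_def dv)
    qed
  qed
  then show ?thesis unfolding is_geodesic_def hunter_saxton_def by blast
qed

theorem mainTheorem2:
  fixes k :: space_kind
  shows
  "(\<forall>X\<in>A1space k.
      (\<lambda>x. deriv (\<lambda>y. (X y)\<^sup>2 / 2) x
            - 1/2 * set_lebesgue_integral lborel {..x} (\<lambda>y. (deriv X y)\<^sup>2)) \<in> A1space k
    \<and> (\<forall>Z\<in>A1space k. ad_star X (Gcheck X) Z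
         = Gcheck (\<lambda>x. deriv (\<lambda>y. (X y)\<^sup>2 / 2) x
            - 1/2 * set_lebesgue_integral lborel {..x} (\<lambda>y. (deriv X y)\<^sup>2)) Z))
   \<and> (\<forall>X\<in>A1space k. in_Gcheck_image (A1space k) (ad_star X (Gcheck X)))
   \<and> (\<forall>a b phi. a < b \<longrightarrow> smooth_curve k {a<..<b} phi \<longrightarrow>
        (is_geodesic k {a<..<b} phi \<longleftrightarrow> hunter_saxton {a<..<b} (rlog phi)))
   \<and> (\<forall>\<phi>0\<in>DiffA1 k. \<forall>\<phi>1\<in>DiffA1 k. \<phi>0 \<noteq> \<phi>1 \<longrightarrow> geodesic_distance k \<phi>0 \<phi>1 > 0)
   \<and> (\<forall>X\<in>Aspace k. X \<noteq> (\<lambda>_. 0) \<longrightarrow> \<not> in_Gcheck_image (Aspace k) (ad_star X (Gcheck X)))"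
proof (intro conjI)
  show "\<forall>X\<in>A1space k.
      (\<lambda>x. deriv (\<lambda>y. (X y)\<^sup>2 / 2) x - 1/2 * (LBINT y:{..x}. (deriv X y)\<^sup>2)) \<in> A1space k
    \<and> (\<forall>Z\<in>A1space k. ad_star X (Gcheck X) Z
         = Gcheck (\<lambda>x. deriv (\<lambda>y. (X y)\<^sup>2 / 2) x - 1/2 * (LBINT y:{..x}. (deriv X y)\<^sup>2)) Z)"
    unfolding hs_field_def[symmetric] using hs_field_A1space ad_star_Gcheck by blast
  show "\<forall>X\<in>A1space k. in_Gcheck_image (A1space k) (ad_star X (Gcheck X))"
    unfolding in_Gcheck_image_def using hs_field_A1space ad_star_Gcheck by blast
qed (use geodesic_iff_hunter_saxton geodesic_distance_pos not_in_Gcheck_image_Aspace in blast)+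

end
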